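(* Let $\mathscr{A}$ be a $C^*$-algebra, let $\mathscr{X}$ be a Hilbert $\mathscr{A}$-module, and let $x,y\in\mathscr{X}$. Then \[ \rho_{-}(x,y)=\min\Big\{\operatorname{Re}\varphi(\langle x,y\rangle):\ \varphi\in\Omega_x\Big\}, \] and in particular the infimum over $\Omega_x$ is attained.
   Context: A Hilbert $\mathscr{A}$-module is a right $\mathscr{A}$-module $\mathscr{X}$ with an $\mathscr{A}$-valued inner product $\langle\cdot,\cdot\rangle$, linear in the second variable and conjugate-linear in the first, with $\langle x,ya\rangle=\langle x,y\rangle a$, $\langle x,y\rangle^*=\langle y,x\rangle$, $\langle x,x\rangle\ge 0$ with equality iff $x=0$, complete for the norm $\|x\|=\|\langle x,x\rangle\|^{1/2}$. A state on $\mathscr{A}$ is a positive linear functional of norm one; $\mathcal{S}(\mathscr{A})$ denotes the set of states. For $x\in\mathscr{X}$, $\Omega_x:=\{\varphi\in\mathcal{S}(\mathscr{A}):\varphi(\langle x,x\rangle)=\|x\|^2\}$. For a normed space $X$ and $x,y\in X$, the norm derivatives are $\rho_{\pm}(x,y):=\lim_{t\to0^{\pm}}\frac{\|x+ty\|^2-\|x\|^2}{2t}$. *)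

theory Defs
  imports "HOL-Analysis.Analysis"
begin

class cvector = real_vector +
  fixes cscale :: "complex \<Rightarrow> 'a \<Rightarrow> 'a"
  assumes cscale_add_right: "cscale c (x + y) = cscale c x + cscale c y"
    and cscale_add_left: "cscale (c + d) x = cscale c x + cscale d x"
    and cscale_cscale: "cscale c (cscale d x) = cscale (c * d) x"
    and cscale_one: "cscale 1 x = x"
    and scaleR_cscale: "scaleR r x = cscale (complex_of_real r) x"

class cstar_algebra = cvector + real_normed_algebra + banach +
  fixes cstar :: "'a \<Rightarrow> 'a"
  assumes norm_cscale: "norm (cscale c x) = cmod c * norm x"
    and cscale_mult_left: "cscale c a * b = cscale c (a * b)"
    and cscale_mult_right: "a * cscale c b = cscale c (a * b)"
    and cstar_add: "cstar (a + b) = cstar a + cstar b"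
    and cstar_cscale: "cstar (cscale c a) = cscale (cnj c) (cstar a)"
    and cstar_mult: "cstar (a * b) = cstar b * cstar a"
    and cstar_cstar: "cstar (cstar a) = a"
    and cstar_identity: "norm (cstar a * a) = (norm a)\<^sup>2"

definition cpos :: "'a::cstar_algebra \<Rightarrow> bool" where
  "cpos a \<longleftrightarrow> (\<exists>b. a = cstar b * b)"

definition cstate :: "('a::cstar_algebra \<Rightarrow> complex) \<Rightarrow> bool" where
  "cstate \<phi> \<longleftrightarrow>
     (\<forall>a b. \<phi> (a + b) = \<phi> a + \<phi> b) \<and>
     (\<forall>c a. \<phi> (cscale c a) = c * \<phi> a) \<and>
     (\<forall>a. cpos a \<longrightarrow> Im (\<phi> a) = 0 \<and> 0 \<le> Re (\<phi> a)) \<and>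
     (\<exists>K. \<forall>a. cmod (\<phi> a) \<le> K * norm a) \<and>
     (SUP a\<in>{a. norm a \<le> 1}. cmod (\<phi> a)) = 1"

definition hm_norm :: "('x \<Rightarrow> 'x \<Rightarrow> 'a::cstar_algebra) \<Rightarrow> 'x \<Rightarrow> real" where
  "hm_norm ip x = sqrt (norm (ip x x))"

definition hilbert_module ::
  "('x::cvector \<Rightarrow> 'a::cstar_algebra \<Rightarrow> 'x) \<Rightarrow> ('x \<Rightarrow> 'x \<Rightarrow> 'a) \<Rightarrow> bool" where
  "hilbert_module act ip \<longleftrightarrow>
     \<comment> \<open>right A-module, compatible with complex scalars\<close>
     (\<forall>x y a. act (x + y) a = act x a + act y a) \<and>
     (\<forall>x a b. act x (a + b) = act x a + act x b) \<and>
     (\<forall>x a b. act x (a * b) = act (act x a) b) \<and>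
     (\<forall>c x a. act (cscale c x) a = cscale c (act x a)) \<and>
     (\<forall>c x a. act x (cscale c a) = cscale c (act x a)) \<and>
     \<comment> \<open>A-valued inner product, linear in the second variable\<close>
     (\<forall>x y z. ip x (y + z) = ip x y + ip x z) \<and>
     (\<forall>c x y. ip x (cscale c y) = cscale c (ip x y)) \<and>
     (\<forall>x y a. ip x (act y a) = ip x y * a) \<and>
     (\<forall>x y. cstar (ip x y) = ip y x) \<and>
     (\<forall>x. cpos (ip x x)) \<and>
     (\<forall>x. ip x x = 0 \<longleftrightarrow> x = 0) \<and>
     \<comment> \<open>completeness for the norm x \<mapsto> sqrt(norm(ip x x))\<close>
     (\<forall>f::nat \<Rightarrow> 'x.
        (\<forall>e>0. \<exists>N. \<forall>m\<ge>N. \<forall>n\<ge>N. hm_norm ip (f m - f n) < e) \<longrightarrow>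
        (\<exists>l. (\<lambda>n. hm_norm ip (f n - l)) \<longlonglongrightarrow> 0))"

definition Omega :: "('x \<Rightarrow> 'x \<Rightarrow> 'a::cstar_algebra) \<Rightarrow> 'x \<Rightarrow> ('a \<Rightarrow> complex) set" where
  "Omega ip x = {\<phi>. cstate \<phi> \<and> \<phi> (ip x x) = complex_of_real ((hm_norm ip x)\<^sup>2)}"

definition norm_deriv_minus :: "('x::real_vector \<Rightarrow> real) \<Rightarrow> 'x \<Rightarrow> 'x \<Rightarrow> real" where
  "norm_deriv_minus N x y =
     Lim (at_left 0) (\<lambda>t::real. ((N (x + t *\<^sub>R y))\<^sup>2 - (N x)\<^sup>2) / (2 * t))"

end

theory Submission
  imports Defs
begin

text \<open>With \<open>a = \<langle>x, x\<rangle>\<close> and \<open>b = \<langle>x, y\<rangle> + \<langle>y, x\<rangle>\<close>, the square \<open>\<parallel>x + t y\<parallel>\<^sup>2\<close> equals \<open>\<parallel>a + t b\<parallel>\<close> up to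
  \<open>O(t\<^sup>2)\<close>, so \<open>\<rho>\<^sub>-(x, y)\<close> is half the left derivative of the norm of the algebra at \<open>a\<close> in
  direction \<open>b\<close>. By Hahn--Banach that derivative is the least value at \<open>b\<close> of a real functional
  \<open>f \<le> \<parallel>\<cdot>\<parallel>\<close> with \<open>f a = \<parallel>a\<parallel>\<close>. Such an \<open>f\<close> is positive, because \<open>\<parallel>a - p\<parallel> \<le> \<parallel>a\<parallel>\<close> for every
  small positive \<open>p\<close>, and complexifying its self-adjoint part yields a state in \<open>\<Omega>\<^sub>x\<close>. That norm
  inequality for elements \<open>p = c\<^sup>* c\<close> rests on the Fukamiya--Kaplansky theorem, obtained in the
  unitization from square roots given by the binomial series.\<close>

section \<open>Involution and positivity in C*-algebras\<close>

lemma cscale_of_real: "cscale (complex_of_real r) x = r *\<^sub>R x"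
  by (simp add: scaleR_cscale)

lemma cscale_zero_left [simp]: "cscale 0 x = 0"
  using cscale_of_real[of 0 x] by simp

lemma cscale_zero_right [simp]: "cscale c 0 = 0"
  by (metis add_cancel_right_right cscale_add_right)

lemma cscale_minus_left: "cscale (- c) x = - cscale c x"
  by (metis add_eq_0_iff cscale_add_left cscale_zero_left add.right_inverse)

lemma cscale_minus_right: "cscale c (- x) = - cscale c x"
  by (metis cscale_cscale cscale_minus_left cscale_one mult_minus1_right)

lemma cscale_diff_right: "cscale c (x - y) = cscale c x - cscale c y"
  by (metis cscale_add_right cscale_minus_right diff_conv_add_uminus)

lemma cscale_scaleR: "cscale c (r *\<^sub>R x) = r *\<^sub>R cscale c x"
  by (simp add: scaleR_cscale cscale_cscale mult.commute)

lemma cscale_ii_ii [simp]: "cscale \<i> (cscale \<i> x) = - x"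
  by (metis cscale_cscale cscale_minus_left cscale_one i_squared)

lemma cscale_Complex: "cscale c x = Re c *\<^sub>R x + Im c *\<^sub>R cscale \<i> x"
proof -
  have "c = complex_of_real (Re c) + complex_of_real (Im c) * \<i>"
    by (simp add: complex_eq_iff)
  then have "cscale c x = cscale (complex_of_real (Re c) + complex_of_real (Im c) * \<i>) x"
    by simp
  then show ?thesis
    by (simp only: cscale_add_left cscale_of_real flip: cscale_cscale)
qed

section \<open>Real linearity and isometry of the involution\<close>

lemma cstar_scaleR: "cstar (r *\<^sub>R a) = r *\<^sub>R cstar (a::'a::cstar_algebra)"
  by (simp add: scaleR_cscale cstar_cscale)

lemma cstar_zero [simp]: "cstar 0 = (0::'a::cstar_algebra)"
  using cstar_scaleR[of 0 "0::'a"] by simp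

lemma cstar_minus: "cstar (- a) = - cstar (a::'a::cstar_algebra)"
  using cstar_scaleR[of "-1" a] by simp

lemma cstar_diff: "cstar (a - b) = cstar a - cstar (b::'a::cstar_algebra)"
  by (simp add: diff_conv_add_uminus cstar_add cstar_minus del: add_uminus_conv_diff)

text \<open>Cancel \<open>norm b\<close> in \<open>norm b * norm b = norm (cstar b * b) \<le> norm
  (cstar b) * norm b\<close>, then do the same for \<open>cstar a\<close>.\<close>

lemma norm_cstar [simp]: "norm (cstar a) = norm (a::'a::cstar_algebra)"
proof -
  have le: "norm b \<le> norm (cstar b)" for b :: 'a
  proof (cases "b = 0")
    case False
    have "norm b * norm b \<le> norm (cstar b) * norm b"
      using norm_mult_ineq[of "cstar b" b] by (simp add: cstar_identity power2_eq_square)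
    with False show ?thesis by simp
  qed simp
  show ?thesis using le[of a] le[of "cstar a"] by (simp add: cstar_cstar)
qed

lemma bounded_linear_cstar: "bounded_linear (cstar :: 'a::cstar_algebra \<Rightarrow> 'a)"
  by (rule bounded_linear_intro[where K=1]) (simp_all add: cstar_add cstar_scaleR)

lemma norm_cstar_mult_self: "norm (cstar a * a) = norm a * norm (a::'a::cstar_algebra)"
  by (simp add: cstar_identity power2_eq_square)

lemma norm_square_selfadjoint:
  fixes q :: "'a::cstar_algebra"
  assumes "cstar q = q"
  shows "norm (q * q) = norm q * norm q"
  using norm_cstar_mult_self[of q] assms by simp

lemma cstar_one [simp]: "cstar 1 = (1::'a::{cstar_algebra,real_normed_algebra_1})"
  by (metis cstar_cstar cstar_mult mult.right_neutral)

section \<open>Self-adjoint real and imaginary parts\<close>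

definition re_part :: "'a::cstar_algebra \<Rightarrow> 'a" where
  "re_part v = (1/2) *\<^sub>R (v + cstar v)"

definition im_part :: "'a::cstar_algebra \<Rightarrow> 'a" where
  "im_part v = (1/2) *\<^sub>R cscale (- \<i>) (v - cstar v)"

lemma cstar_re_part [simp]: "cstar (re_part v) = re_part v"
  by (simp add: re_part_def cstar_scaleR cstar_add cstar_cstar add.commute)

lemma cstar_im_part [simp]: "cstar (im_part v) = im_part v"
  by (simp add: im_part_def cstar_scaleR cstar_diff cstar_cscale cstar_cstar
      cscale_minus_left cscale_diff_right)

lemma norm_re_part: "norm (re_part v) \<le> norm v"
  using norm_triangle_ineq[of v "cstar v"] by (simp add: re_part_def)

lemma norm_im_part: "norm (im_part v) \<le> norm v"
  using norm_triangle_ineq4[of v "cstar v"] by (simp add: im_part_def norm_cscale)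

lemma re_im_decomp: "v = re_part v + cscale \<i> (im_part v)"
proof -
  have "cscale \<i> (im_part v) = (1/2) *\<^sub>R (v - cstar v)"
    by (simp add: im_part_def cscale_scaleR cscale_cscale cscale_one)
  then have "re_part v + cscale \<i> (im_part v) = (1/2) *\<^sub>R (v + v)"
    by (simp add: re_part_def flip: scaleR_add_right)
  also have "\<dots> = v" by (simp flip: scaleR_2)
  finally show ?thesis by simp
qed

lemma im_part_add_cscale_ii:
  assumes "cstar s = s" "cstar q = q"
  shows "im_part (s + cscale \<i> q) = q"
proof -
  have c: "cstar (s + cscale \<i> q) = s - cscale \<i> q"
    using assms by (simp add: cstar_add cstar_cscale cscale_minus_left)
  have "s + cscale \<i> q - (s - cscale \<i> q) = 2 *\<^sub>R cscale \<i> q"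
    by (simp add: scaleR_2)
  then show "im_part (s + cscale \<i> q) = q"
    unfolding im_part_def c by (simp add: cscale_scaleR cscale_minus_left)
qed

subsection \<open>Square roots by the binomial series\<close>

text \<open>Taylor coefficients of the square root of \<open>1 - z\<close> at 0.\<close>

definition sqrt_coeff :: "nat \<Rightarrow> real" where
  "sqrt_coeff n = ((1/2) gchoose n) * (- 1) ^ n"

lemma sqrt_coeff_0 [simp]: "sqrt_coeff 0 = 1"
  by (simp add: sqrt_coeff_def)

text \<open>Alternating partial sums of binomial coefficients have a closed form; negating its upper
  index leaves a product of positive factors \<open>m - 1/2 - i\<close> with
  \<open>i < m\<close>.\<close>

lemma sum_sqrt_coeff_nonneg: "0 \<le> (\<Sum>k\<le>m. sqrt_coeff k)"
proof -
  have "(\<Sum>k\<le>m. sqrt_coeff k) = (- 1) ^ m * ((- 1/2::real) gchoose m)"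
    unfolding sqrt_coeff_def by (simp add: gbinomial_sum_lower_neg)
  also have "\<dots> = ((of_nat m - 1/2) gchoose m)"
    by (subst gbinomial_negated_upper) (simp flip: power_mult_distrib add: algebra_simps)
  also have "\<dots> \<ge> 0"
    by (auto simp: gbinomial_prod_rev intro!: divide_nonneg_nonneg prod_nonneg)
  finally show ?thesis .
qed

text \<open>Exactly one factor of the product is negative: the last one,
  \<open>-1/2\<close>.\<close>

lemma sqrt_coeff_Suc_nonpos: "sqrt_coeff (Suc n) \<le> 0"
proof -
  have "((1/2::real) gchoose Suc n) * (- 1) ^ Suc n = ((of_nat (Suc n) - 1/2 - 1) gchoose Suc n)"
    by (subst gbinomial_negated_upper) (simp flip: power_mult_distrib add: algebra_simps)
  also have "\<dots> = (\<Prod>i=0..n. (real n - 1/2) - real i) / fact (Suc n)"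
    by (simp add: gbinomial_Suc algebra_simps)
  also have "\<dots> = ((\<Prod>i=0..<n. (real n - 1/2) - real i) * (- 1/2)) / fact (Suc n)"
    by (simp add: atLeast0AtMost lessThan_Suc_atMost[symmetric] atLeast0LessThan)
  also have "\<dots> \<le> 0"
    by (auto intro!: divide_nonneg_nonneg prod_nonneg simp del: fact_Suc)
  finally show ?thesis unfolding sqrt_coeff_def .
qed

text \<open>All these coefficients have the same sign, so the sum is 1 minus a nonnegative partial
  sum. The bound gives convergence on the closed unit ball and the estimate on \<open>1 - s\<close>
  below.\<close>

lemma sum_abs_sqrt_coeff_Suc: "(\<Sum>k<m. \<bar>sqrt_coeff (Suc k)\<bar>) \<le> 1"
proof -
  have "(\<Sum>k<m. \<bar>sqrt_coeff (Suc k)\<bar>) = - (\<Sum>k<m. sqrt_coeff (Suc k))"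
    using sqrt_coeff_Suc_nonpos by (simp flip: sum_negf)
  also have "(\<Sum>k<m. sqrt_coeff (Suc k)) = (\<Sum>k\<le>m. sqrt_coeff k) - 1"
    by (simp add: sum.atMost_shift)
  finally show ?thesis using sum_sqrt_coeff_nonneg[of m] by linarith
qed

lemma summable_abs_sqrt_coeff: "summable (\<lambda>n. \<bar>sqrt_coeff n\<bar>)"
proof -
  have "summable (\<lambda>n. \<bar>sqrt_coeff (Suc n)\<bar>)"
    by (rule bounded_imp_summable[where B=1])
      (simp_all only: abs_ge_zero sum_abs_sqrt_coeff_Suc flip: lessThan_Suc_atMost)
  then show ?thesis by (subst (asm) summable_Suc_iff)
qed

text \<open>Vandermonde with \<open>1/2 + 1/2 = 1\<close>: the squared series is
  \<open>1 - z\<close>.\<close>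

lemma sqrt_coeff_convolution:
  "(\<Sum>i\<le>n. sqrt_coeff i * sqrt_coeff (n - i)) = (if n = 0 then 1 else if n = 1 then - 1 else 0)"
proof -
  have "(\<Sum>i\<le>n. sqrt_coeff i * sqrt_coeff (n - i))
      = (\<Sum>i\<le>n. ((1/2) gchoose i) * ((1/2) gchoose (n - i)) * (- 1) ^ n)"
    unfolding sqrt_coeff_def
    by (intro sum.cong refl) (auto simp flip: power_add)
  also have "\<dots> = ((1/2 + 1/2) gchoose n) * (- 1 :: real) ^ n"
    by (simp only: gbinomial_Vandermonde[symmetric] atLeast0AtMost sum_distrib_right)
  also have "\<dots> = (real (1 choose n)) * (- 1) ^ n"
    by (simp add: binomial_gbinomial)
  also have "\<dots> = (if n = 0 then 1 else if n = 1 then - 1 else 0)"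
    by (auto simp: binomial_eq_0)
  finally show ?thesis .
qed

lemma sqrt_one_minus:
  fixes z :: "'a::{real_normed_algebra_1,banach}"
  assumes z: "norm z \<le> 1"
  defines "s \<equiv> (\<Sum>n. sqrt_coeff n *\<^sub>R z ^ n)"
  shows "(\<lambda>n. sqrt_coeff n *\<^sub>R z ^ n) sums s" "s * s = 1 - z" "norm (1 - s) \<le> 1"
proof -
  have le: "norm (sqrt_coeff n *\<^sub>R z ^ n) \<le> \<bar>sqrt_coeff n\<bar>" for n
    using norm_power_ineq[of z n] power_le_one[OF norm_ge_zero z, of n]
    by (simp add: mult_left_le)
  have sn: "summable (\<lambda>n. norm (sqrt_coeff n *\<^sub>R z ^ n))"
    by (rule summable_comparison_test'[OF summable_abs_sqrt_coeff, of 0]) (use le in simp)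
  then show sums: "(\<lambda>n. sqrt_coeff n *\<^sub>R z ^ n) sums s"
    unfolding s_def by (rule summable_sums[OF summable_norm_cancel])
  have "(\<lambda>k. \<Sum>i\<le>k. (sqrt_coeff i *\<^sub>R z ^ i) * (sqrt_coeff (k - i) *\<^sub>R z ^ (k - i))) sums (s * s)"
    unfolding s_def by (rule Cauchy_product_sums[OF sn sn])
  moreover have "(\<Sum>i\<le>k. (sqrt_coeff i *\<^sub>R z ^ i) * (sqrt_coeff (k - i) *\<^sub>R z ^ (k - i)))
      = (if k = 0 then 1 else if k = 1 then - z else 0)" for k
  proof -
    have "(\<Sum>i\<le>k. (sqrt_coeff i *\<^sub>R z ^ i) * (sqrt_coeff (k - i) *\<^sub>R z ^ (k - i)))
        = (\<Sum>i\<le>k. sqrt_coeff i * sqrt_coeff (k - i)) *\<^sub>R z ^ k"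
      unfolding scaleR_sum_left
      by (intro sum.cong refl) (auto simp flip: power_add)
    then show ?thesis unfolding sqrt_coeff_convolution by simp
  qed
  ultimately have "(\<lambda>k. if k = 0 then 1 else if k = 1 then - z else 0) sums (s * s)"
    by simp
  moreover have "(\<lambda>k. if k = 0 then 1 else if k = 1 then - z else 0)
      sums (\<Sum>k\<in>{0, 1::nat}. if k = 0 then 1 else if k = 1 then - z else 0)"
    by (rule sums_finite) auto
  ultimately show "s * s = 1 - z"
    by (simp add: sums_iff)
  \<comment> \<open>Without the constant term 1, the absolute values of the coefficients add up to
    at most 1.\<close>
  have "(\<lambda>n. sqrt_coeff (Suc n) *\<^sub>R z ^ Suc n) sums (s - 1)"
    using sums by (subst sums_Suc_iff) simp
  then have "(\<lambda>m. norm (\<Sum>n<m. sqrt_coeff (Suc n) *\<^sub>R z ^ Suc n)) \<longlonglongrightarrow> norm (s - 1)"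
    unfolding sums_def by (rule tendsto_norm)
  moreover have "norm (\<Sum>n<m. sqrt_coeff (Suc n) *\<^sub>R z ^ Suc n) \<le> 1" for m
    using sum_norm_le[of "{..<m}" "\<lambda>n. sqrt_coeff (Suc n) *\<^sub>R z ^ Suc n", OF le]
      sum_abs_sqrt_coeff_Suc[of m]
    by linarith
  ultimately have "norm (s - 1) \<le> 1"
    by (intro LIMSEQ_le_const2) auto
  then show "norm (1 - s) \<le> 1" by (simp add: norm_minus_commute)
qed

text \<open>The root is a limit of real polynomials in \<open>z\<close>, so it inherits
  self-adjointness and every commutation relation of \<open>z\<close>.\<close>

lemma sqrt_one_minus_selfadjoint:
  fixes z :: "'a::{cstar_algebra,real_normed_algebra_1}"
  assumes z: "norm z \<le> 1" and sa: "cstar z = z"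
  obtains s where "s * s = 1 - z" "norm (1 - s) \<le> 1" "cstar s = s"
    "\<And>w. w * z = z * w \<Longrightarrow> w * s = s * w"
proof -
  define s where "s = (\<Sum>n. sqrt_coeff n *\<^sub>R z ^ n)"
  note s = sqrt_one_minus[OF z, folded s_def]
  have pow: "cstar (z ^ n) = z ^ n" for n
    by (induction n) (simp_all add: cstar_mult sa power_commutes)
  have "(\<lambda>n. cstar (sqrt_coeff n *\<^sub>R z ^ n)) sums cstar s"
    by (rule bounded_linear.sums[OF bounded_linear_cstar s(1)])
  then have "cstar s = s"
    using s(1) by (simp add: cstar_scaleR pow sums_iff)
  moreover have "w * s = s * w" if w: "w * z = z * w" for w
  proof -
    have "w * z ^ n = z ^ n * w" for n
      by (induction n) (simp, metis power_Suc w mult.assoc)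
    then show ?thesis
      using sums_mult[OF s(1), of w] sums_mult2[OF s(1), of w] by (simp add: sums_iff)
  qed
  ultimately show ?thesis using that s by blast
qed

subsection \<open>Squares of self-adjoint elements in a unital C*-algebra\<close>

text \<open>A form of positivity suited to roots from power series. It implies \<open>cpos\<close>
  at once; the converse, in the unital case, is \<open>sq_pos_cstar_mult_self\<close>.\<close>

definition sq_pos :: "'a::cstar_algebra \<Rightarrow> bool" where
  "sq_pos a \<longleftrightarrow> (\<exists>q. cstar q = q \<and> a = q * q)"

lemma sq_pos_square: "cstar q = q \<Longrightarrow> sq_pos (q * q)"
  by (auto simp: sq_pos_def)

lemma sq_pos_selfadjoint: "sq_pos a \<Longrightarrow> cstar a = a"
  by (auto simp: sq_pos_def cstar_mult)

lemma sq_pos_scaleR: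
  assumes "sq_pos a" "0 \<le> r"
  shows "sq_pos (r *\<^sub>R a)"
proof -
  obtain q where q: "cstar q = q" "a = q * q" using assms(1) by (auto simp: sq_pos_def)
  have "r *\<^sub>R a = (sqrt r *\<^sub>R q) * (sqrt r *\<^sub>R q)"
    using assms(2) q(2) by simp
  then show ?thesis
    unfolding sq_pos_def using q(1) by (metis cstar_scaleR)
qed

lemma sq_pos_one: "sq_pos (1::'a::{cstar_algebra,real_normed_algebra_1})"
  using sq_pos_square[of "1::'a"] by simp

text \<open>\<open>s + iq\<close> is unitary.\<close>
lemma norm_le_one_if_sum_squares_one:
  fixes s q :: "'a::{cstar_algebra,real_normed_algebra_1}"
  assumes sa: "cstar s = s" "cstar q = q" and comm: "s * q = q * s" and one: "s * s + q * q = 1"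
  shows "norm q \<le> 1"
proof -
  define v where "v = s + cscale \<i> q"
  have "cstar v * v = (s - cscale \<i> q) * (s + cscale \<i> q)"
    by (simp add: v_def cstar_add cstar_cscale sa cscale_minus_left)
  also have "\<dots> = s * s + q * q"
    by (simp add: algebra_simps cscale_mult_left cscale_mult_right comm cscale_diff_right)
  finally have "norm v * norm v = 1"
    using norm_cstar_mult_self[of v] one by simp
  then have "norm v = 1"
    by (metis abs_norm_cancel real_sqrt_abs2 real_sqrt_one)
  then show ?thesis
    using norm_im_part[of v] im_part_add_cscale_ii[OF sa] by (simp add: v_def)
qed

text \<open>Double-angle formulas: reading \<open>q\<close> as a sine and the root \<open>s\<close>
  of \<open>1 - q * q\<close> as the cosine, \<open>2 s q\<close> and \<open>1 - 2 q q\<close> are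
  the sine and cosine of the doubled angle, so their squares add up to 1.\<close>

lemma norm_one_minus_two_square:
  fixes q :: "'a::{cstar_algebra,real_normed_algebra_1}"
  assumes q: "cstar q = q" "norm q \<le> 1"
  shows "norm (1 - 2 *\<^sub>R (q * q)) \<le> 1"
proof -
  have "norm (q * q) \<le> 1"
    using norm_square_selfadjoint[OF q(1)] q(2) by (simp add: mult_le_one)
  moreover have "cstar (q * q) = q * q" by (simp add: cstar_mult q)
  ultimately obtain s where s: "s * s = 1 - q * q" "cstar s = s"
    "\<And>w. w * (q * q) = (q * q) * w \<Longrightarrow> w * s = s * w"
    by (metis sqrt_one_minus_selfadjoint)
  have comm: "q * s = s * q" by (rule s(3)) (simp add: mult.assoc)
  have ssq: "s * s = 1 - q * q" by (rule s(1))
  define p where "p = q * q"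
  have p: "s * p = p * s" unfolding p_def by (metis comm mult.assoc)
  have sqsq: "(s * q) * (s * q) = p - p * p"
  proof -
    have "(s * q) * (s * q) = (s * s) * (q * q)" by (metis comm mult.assoc)
    then show ?thesis by (simp add: ssq p_def algebra_simps)
  qed
  show ?thesis
  proof (rule norm_le_one_if_sum_squares_one)
    show "cstar (2 *\<^sub>R (s * q)) = 2 *\<^sub>R (s * q)"
      by (simp add: cstar_scaleR cstar_mult s q comm)
    show "cstar (1 - 2 *\<^sub>R (q * q)) = 1 - 2 *\<^sub>R (q * q)"
      by (simp add: cstar_diff cstar_scaleR cstar_mult q)
    have "(s * q) * p = p * (s * q)"
      unfolding p_def by (metis comm mult.assoc)
    then show "2 *\<^sub>R (s * q) * (1 - 2 *\<^sub>R (q * q)) = (1 - 2 *\<^sub>R (q * q)) * (2 *\<^sub>R (s * q))"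
      by (simp add: p_def algebra_simps)
    show "2 *\<^sub>R (s * q) * (2 *\<^sub>R (s * q)) + (1 - 2 *\<^sub>R (q * q)) * (1 - 2 *\<^sub>R (q * q)) = 1"
    proof -
      have "2 *\<^sub>R (s * q) * (2 *\<^sub>R (s * q)) = 4 *\<^sub>R (p - p * p)" by (simp add: sqsq)
      moreover have "(1 - 2 *\<^sub>R p) * (1 - 2 *\<^sub>R p) = 1 - 4 *\<^sub>R p + 4 *\<^sub>R (p * p)"
        using scaleR_add_left[of 2 2 p] by (simp add: algebra_simps)
      ultimately show ?thesis by (simp add: p_def scaleR_diff_right)
    qed
  qed
qed

text \<open>This condition and its converse below replace the spectral description of positivity: it
  says that the spectrum lies in \<open>[0, 2 t]\<close>.\<close>

lemma sq_pos_near_multiple_of_one: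
  fixes a :: "'a::{cstar_algebra,real_normed_algebra_1}"
  assumes "sq_pos a"
  obtains t where "0 < t" "norm (t *\<^sub>R 1 - a) \<le> t"
proof -
  obtain q where q: "cstar q = q" "a = q * q" using assms by (auto simp: sq_pos_def)
  \<comment> \<open>\<open>(1/T) q\<close> is a contraction, and the added 1 keeps \<open>T\<close>
    positive when \<open>q = 0\<close>. Rescaling leads to \<open>t = T * T / 2\<close>.\<close>
  define T where "T = norm q + 1"
  have T: "T > 0" by (simp add: T_def add_nonneg_pos)
  have "norm (1 - 2 *\<^sub>R (((1/T) *\<^sub>R q) * ((1/T) *\<^sub>R q))) \<le> 1"
    using T by (intro norm_one_minus_two_square) (simp_all add: cstar_scaleR q T_def)
  then have "norm ((T*T/2) *\<^sub>R (1 - 2 *\<^sub>R (((1/T) *\<^sub>R q) * ((1/T) *\<^sub>R q)))) \<le> T*T/2"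
    using T by (simp add: mult_left_le)
  also have "(T*T/2) *\<^sub>R (1 - 2 *\<^sub>R (((1/T) *\<^sub>R q) * ((1/T) *\<^sub>R q))) = (T*T/2) *\<^sub>R 1 - a"
    using T by (simp add: q(2) scaleR_diff_right)
  finally show ?thesis using that[of "T*T/2"] T by simp
qed

text \<open>Here \<open>a = t (1 - z)\<close> with \<open>z\<close> in the unit ball, so the
  binomial series yields a root.\<close>

lemma sqrt_if_near_multiple_of_one:
  fixes a :: "'a::{cstar_algebra,real_normed_algebra_1}"
  assumes "cstar a = a" "0 < t" "norm (t *\<^sub>R 1 - a) \<le> t"
  obtains q where "cstar q = q" "a = q * q" "\<And>w. w * a = a * w \<Longrightarrow> w * q = q * w"
proof -
  define z where "z = 1 - (1/t) *\<^sub>R a"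
  have "t *\<^sub>R 1 - a = t *\<^sub>R z" using assms(2) by (simp add: z_def scaleR_diff_right)
  then have "norm z \<le> 1" using assms(2,3) by simp
  moreover have "cstar z = z" by (simp add: z_def cstar_diff cstar_scaleR assms(1))
  ultimately obtain s where s: "s * s = 1 - z" "cstar s = s"
    "\<And>w. w * z = z * w \<Longrightarrow> w * s = s * w"
    by (metis sqrt_one_minus_selfadjoint)
  show ?thesis
  proof (rule that)
    show "cstar (sqrt t *\<^sub>R s) = sqrt t *\<^sub>R s" by (simp add: cstar_scaleR s)
    show "a = (sqrt t *\<^sub>R s) * (sqrt t *\<^sub>R s)"
      using assms(2) by (simp add: s(1)) (simp add: z_def)
    fix w assume "w * a = a * w"
    then have "w * s = s * w" by (intro s(3)) (simp add: z_def algebra_simps)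
    then show "w * (sqrt t *\<^sub>R s) = (sqrt t *\<^sub>R s) * w" by simp
  qed
qed

lemma sq_posI_near_multiple_of_one:
  fixes a :: "'a::{cstar_algebra,real_normed_algebra_1}"
  assumes "cstar a = a" "0 < t" "norm (t *\<^sub>R 1 - a) \<le> t"
  shows "sq_pos a"
  using sqrt_if_near_multiple_of_one[OF assms] unfolding sq_pos_def by metis

text \<open>The root in \<open>sq_pos\<close> is arbitrary; passing through the ball condition
  replaces it by one that commutes with the commutant of \<open>a\<close>.\<close>

lemma sq_pos_sqrt:
  fixes a :: "'a::{cstar_algebra,real_normed_algebra_1}"
  assumes "sq_pos a"
  obtains q where "cstar q = q" "a = q * q" "\<And>w. w * a = a * w \<Longrightarrow> w * q = q * w"
proof -
  obtain t where "0 < t" "norm (t *\<^sub>R 1 - a) \<le> t"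
    using sq_pos_near_multiple_of_one[OF assms] by blast
  then show ?thesis
    using sqrt_if_near_multiple_of_one[OF sq_pos_selfadjoint[OF assms]] that by blast
qed

text \<open>Ball conditions add up by the triangle inequality.\<close>

lemma sq_pos_add:
  fixes a b :: "'a::{cstar_algebra,real_normed_algebra_1}"
  assumes "sq_pos a" "sq_pos b"
  shows "sq_pos (a + b)"
proof -
  obtain t where t: "0 < t" "norm (t *\<^sub>R 1 - a) \<le> t"
    using sq_pos_near_multiple_of_one assms(1) by blast
  obtain u where u: "0 < u" "norm (u *\<^sub>R 1 - b) \<le> u"
    using sq_pos_near_multiple_of_one assms(2) by blast
  show ?thesis
  proof (rule sq_posI_near_multiple_of_one)
    show "cstar (a + b) = a + b" by (simp add: cstar_add sq_pos_selfadjoint assms)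
    have "(t + u) *\<^sub>R 1 - (a + b) = (t *\<^sub>R 1 - a) + (u *\<^sub>R 1 - b)"
      by (simp add: algebra_simps)
    then show "norm ((t + u) *\<^sub>R 1 - (a + b)) \<le> t + u"
      using norm_triangle_mono[OF t(2) u(2)] by (rule ssubst[where P="\<lambda>v. norm v \<le> t + u"])
  qed (use t u in simp)
qed

text \<open>Using the commutation property of the roots twice shows that they commute with each
  other, so \<open>a * b\<close> is the square of their product.\<close>

lemma sq_pos_mult_commuting:
  fixes a b :: "'a::{cstar_algebra,real_normed_algebra_1}"
  assumes "sq_pos a" "sq_pos b" "a * b = b * a"
  shows "sq_pos (a * b)"
proof -
  obtain q where q: "cstar q = q" "a = q * q" "\<And>w. w * a = a * w \<Longrightarrow> w * q = q * w"
    using sq_pos_sqrt assms(1) by blast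
  obtain r where r: "cstar r = r" "b = r * r" "\<And>w. w * b = b * w \<Longrightarrow> w * r = r * w"
    using sq_pos_sqrt assms(2) by blast
  have "b * q = q * b" using q(3) assms(3) by simp
  then have qr: "q * r = r * q" using r(3)[of q] by simp
  have "a * b = (q * r) * (q * r)"
    unfolding q(2) r(2) by (metis qr mult.assoc)
  then show ?thesis
    unfolding sq_pos_def by (metis cstar_mult q(1) r(1) qr)
qed

text \<open>The product \<open>(1 - k) (1 + k) = 1 - k k\<close> is positive; its root
  \<open>s\<close> commutes with \<open>k\<close> and \<open>s s + k k = 1\<close>.\<close>

lemma norm_le_one_if_between:
  fixes k :: "'a::{cstar_algebra,real_normed_algebra_1}"
  assumes "sq_pos (1 - k)" "sq_pos (1 + k)"
  shows "norm k \<le> 1"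
proof -
  have "sq_pos ((1 - k) * (1 + k))"
    by (rule sq_pos_mult_commuting[OF assms]) (simp add: algebra_simps)
  then have "sq_pos (1 - k * k)" by (simp add: algebra_simps)
  then obtain s where s: "cstar s = s" "1 - k * k = s * s"
    "\<And>w. w * (1 - k * k) = (1 - k * k) * w \<Longrightarrow> w * s = s * w"
    using sq_pos_sqrt by blast
  have "cstar k = k"
    using sq_pos_selfadjoint[OF assms(1)] by (simp add: cstar_diff)
  moreover have "k * s = s * k" by (rule s(3)) (simp add: algebra_simps)
  moreover have "s * s + k * k = 1" using s(2) by (simp add: algebra_simps)
  ultimately show ?thesis using norm_le_one_if_sum_squares_one s(1) by metis
qed

text \<open>The root of \<open>a\<close> is a contraction, so \<open>1 - 2 a\<close> has norm at
  most 1. Halving it gives the ball condition for \<open>1 - a\<close> with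
  \<open>t = 1/2\<close>.\<close>

lemma sq_pos_one_minus:
  fixes a :: "'a::{cstar_algebra,real_normed_algebra_1}"
  assumes "sq_pos a" "norm a \<le> 1"
  shows "sq_pos (1 - a)"
proof -
  obtain q where q: "cstar q = q" "a = q * q" using assms(1) by (auto simp: sq_pos_def)
  have "norm q * norm q \<le> 1" using assms(2) norm_square_selfadjoint[OF q(1)] q(2) by simp
  then have "norm q \<le> 1"
    by (metis abs_norm_cancel abs_square_le_1 power2_eq_square)
  then have n: "norm (1 - 2 *\<^sub>R a) \<le> 1"
    using norm_one_minus_two_square q by blast
  have e: "(1/2) *\<^sub>R 1 - (1 - a) = - ((1/2) *\<^sub>R (1 - 2 *\<^sub>R a))"
  proof -
    have "(1::'a) = (1/2) *\<^sub>R 1 + (1/2) *\<^sub>R 1" by (simp flip: scaleR_add_left)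
    then show ?thesis by (simp add: algebra_simps)
  qed
  show ?thesis
  proof (rule sq_posI_near_multiple_of_one)
    show "cstar (1 - a) = 1 - a" by (simp add: cstar_diff sq_pos_selfadjoint assms(1))
    show "norm ((1/2) *\<^sub>R 1 - (1 - a)) \<le> 1/2" unfolding e using n by simp
  qed simp
qed

lemma norm_one_minus_sq_pos:
  fixes a :: "'a::{cstar_algebra,real_normed_algebra_1}"
  assumes "sq_pos a" "norm a \<le> 1"
  shows "norm (1 - a) \<le> 1"
  using sq_pos_add[OF sq_pos_one sq_pos_one_minus[OF assms]] assms(1)
  by (intro norm_le_one_if_between) simp_all

text \<open>Since \<open>d\<^sup>* d (1 - d\<^sup>* d) = d\<^sup>* (1 - d d\<^sup>*) d\<close>, the element \<open>k = - d\<^sup>* d\<close> of norm one would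
  satisfy \<open>\<parallel>k + k\<^sup>2\<parallel> \<le> 1\<close>, which is impossible for a positive \<open>k\<close>.\<close>
lemma eq_zero_if_neg_cstar_mult_self_sq_pos:
  fixes d :: "'a::{cstar_algebra,real_normed_algebra_1}"
  assumes "sq_pos (- (cstar d * d))"
  shows "d = 0"
proof (rule ccontr)
  assume "d \<noteq> 0"
  define e where "e = (1 / norm d) *\<^sub>R d"
  have ne: "norm e = 1" using \<open>d \<noteq> 0\<close> by (simp add: e_def)
  define k where "k = - (cstar e * e)"
  define m where "m = e * cstar e"
  have "k = (1 / (norm d * norm d)) *\<^sub>R (- (cstar d * d))"
    by (simp add: k_def e_def cstar_scaleR)
  then have k: "sq_pos k" using sq_pos_scaleR[OF assms] by simp
  have nk: "norm k = 1" using norm_cstar_mult_self[of e] ne by (simp add: k_def)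
  have nm: "norm m = 1" using norm_cstar_mult_self[of "cstar e"] ne by (simp add: m_def cstar_cstar)
  define u where "u = re_part e"
  define w where "w = im_part e"
  have euw: "e = u + cscale \<i> w" unfolding u_def w_def by (rule re_im_decomp)
  have cuw: "cstar u = u" "cstar w = w" by (simp_all add: u_def w_def)
  have ce: "cstar e = u - cscale \<i> w"
    unfolding euw by (simp add: cstar_add cstar_cscale cuw cscale_minus_left)
  \<comment> \<open>The mixed terms of \<open>e e\<^sup>*\<close> and \<open>e\<^sup>* e\<close>
    cancel in the sum, hence \<open>m - k = 2 u u + 2 w w\<close> and \<open>m\<close> is
    positive.\<close>
  have "m = 2 *\<^sub>R (u * u) + 2 *\<^sub>R (w * w) + k"
    unfolding m_def k_def ce unfolding euw
    by (simp add: algebra_simps cscale_mult_left cscale_mult_right scaleR_2 cscale_diff_right cscale_add_right)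
  then have m: "sq_pos m"
    using k cuw by (auto intro!: sq_pos_add sq_pos_scaleR sq_pos_square)
  have "norm (1 - m) \<le> 1" using norm_one_minus_sq_pos[OF m] nm by simp
  moreover have "k + k * k = - (cstar e * (1 - m) * e)"
    by (simp add: k_def m_def algebra_simps)
  ultimately have "norm (k + k * k) \<le> 1"
    using norm_mult_ineq[of "cstar e * (1 - m)" e] norm_mult_ineq[of "cstar e" "1 - m"] ne by simp
  moreover have "sq_pos (k + k * k)"
    using k sq_pos_selfadjoint[OF k] by (intro sq_pos_add sq_pos_square)
  ultimately have 1: "sq_pos (1 - (k + k * k))" by (rule sq_pos_one_minus[rotated])
  \<comment> \<open>Adding this square to \<open>1 - k - k k\<close> cancels \<open>k k\<close> and
    leaves \<open>5/4 - 2 k\<close>. Its positivity bounds the norm of \<open>k\<close> by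
    \<open>5/8\<close>, against \<open>norm k = 1\<close>.\<close>
  have 2: "sq_pos ((k - (1/2) *\<^sub>R 1) * (k - (1/2) *\<^sub>R 1))"
    by (rule sq_pos_square) (simp add: cstar_diff cstar_scaleR sq_pos_selfadjoint[OF k])
  have "(1 - (k + k * k)) + (k - (1/2) *\<^sub>R 1) * (k - (1/2) *\<^sub>R 1) = (5/4) *\<^sub>R (1 - (8/5) *\<^sub>R k)"
  proof -
    have "(k - (1/2) *\<^sub>R 1) * (k - (1/2) *\<^sub>R 1) = k * k - k + (1/4) *\<^sub>R 1"
    proof -
      have "k = (1/2) *\<^sub>R k + (1/2) *\<^sub>R k" by (simp flip: scaleR_add_left)
      then show ?thesis by (simp add: algebra_simps)
    qed
    moreover have "(5/4::real) *\<^sub>R 1 = (1::'a) + (1/4) *\<^sub>R 1"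
      using scaleR_add_left[of 1 "1/4" "1::'a"] by simp
    ultimately show ?thesis by (simp add: algebra_simps scaleR_2)
  qed
  then have "sq_pos ((5/4) *\<^sub>R (1 - (8/5) *\<^sub>R k))" using sq_pos_add[OF 1 2] by simp
  then have "sq_pos ((4/5) *\<^sub>R ((5/4) *\<^sub>R (1 - (8/5) *\<^sub>R k)))" by (rule sq_pos_scaleR) simp
  then have "sq_pos (1 - (8/5) *\<^sub>R k)" by simp
  moreover have "sq_pos (1 + (8/5) *\<^sub>R k)"
    by (intro sq_pos_add sq_pos_one sq_pos_scaleR k) simp
  ultimately have "norm ((8/5) *\<^sub>R k) \<le> 1" by (rule norm_le_one_if_between)
  then show False using nk by simp
qed

text \<open>With \<open>h = c\<^sup>* c\<close>, \<open>s = |h|\<close> and \<open>n = s - h\<close>, the element \<open>d = c n\<close> satisfies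
  \<open>d\<^sup>* d = n h n = - n s n\<close>, so \<open>d = 0\<close> and hence \<open>n\<^sup>3 = 0\<close>.\<close>
lemma sq_pos_cstar_mult_self:
  fixes c :: "'a::{cstar_algebra,real_normed_algebra_1}"
  shows "sq_pos (cstar c * c)"
proof -
  have contraction: "sq_pos (cstar c * c)" if "norm c \<le> 1" for c :: 'a
  proof -
    define h where "h = cstar c * c"
    have h: "cstar h = h" by (simp add: h_def cstar_mult cstar_cstar)
    have "norm h \<le> 1" using that by (simp add: h_def norm_cstar_mult_self mult_le_one)
    then have "norm (h * h) \<le> 1" by (simp add: norm_square_selfadjoint[OF h] mult_le_one)
    then have "norm (1 - h * h) \<le> 1"
      by (intro norm_one_minus_sq_pos sq_pos_square h)
    moreover have "cstar (1 - h * h) = 1 - h * h" by (simp add: cstar_diff cstar_mult h)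
    ultimately obtain s where s: "s * s = 1 - (1 - h * h)" "norm (1 - s) \<le> 1" "cstar s = s"
      "\<And>w. w * (1 - h * h) = (1 - h * h) * w \<Longrightarrow> w * s = s * w"
      by (metis sqrt_one_minus_selfadjoint)
    have hs: "h * s = s * h" by (rule s(4)) (simp add: algebra_simps)
    have ss: "s * s = h * h" using s(1) by simp
    have spos: "sq_pos s"
      using sq_posI_near_multiple_of_one[of s 1] s(2,3) by simp
    \<comment> \<open>Twice the negative part of \<open>h\<close>. Once it vanishes,
      \<open>h = s\<close> is positive.\<close>
    define n where "n = s - h"
    have n: "cstar n = n" by (simp add: n_def cstar_diff s h)
    have ns: "n * s = s * n" by (simp add: n_def algebra_simps hs)
    have nhs: "n * h = - (n * s)" by (simp add: n_def algebra_simps hs ss)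
    have "cstar (c * n) * (c * n) = n * h * n" by (simp add: cstar_mult n h_def mult.assoc)
    then have "- (cstar (c * n) * (c * n)) = n * s * n" by (simp add: nhs)
    also have "\<dots> = (n * n) * s" by (metis ns mult.assoc)
    finally have nsn: "- (cstar (c * n) * (c * n)) = (n * n) * s" .
    have "sq_pos ((n * n) * s)"
      by (rule sq_pos_mult_commuting[OF sq_pos_square[OF n] spos]) (metis ns mult.assoc)
    then have "c * n = 0" using eq_zero_if_neg_cstar_mult_self_sq_pos nsn by metis
    then have hn: "h * n = 0" by (simp add: h_def mult.assoc)
    have "n * h = cstar (h * n)" by (simp add: cstar_mult h n)
    then have "s * n = 0" using nhs ns hn by simp
    then have "n * n = 0" using hn by (simp add: n_def algebra_simps)
    then have "n = 0" using norm_square_selfadjoint[OF n] by simp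
    then show ?thesis using spos by (simp add: n_def h_def)
  qed
  \<comment> \<open>A general \<open>c\<close> is scaled into the unit ball; the added 1 avoids
    division by zero.\<close>
  define r where "r = 1 + norm c"
  have r: "r > 0" by (simp add: r_def add_pos_nonneg)
  have "sq_pos (cstar ((1/r) *\<^sub>R c) * ((1/r) *\<^sub>R c))"
    using r by (intro contraction) (simp add: r_def)
  then have "sq_pos ((r*r) *\<^sub>R (cstar ((1/r) *\<^sub>R c) * ((1/r) *\<^sub>R c)))"
    using r by (intro sq_pos_scaleR) simp_all
  then show ?thesis using r by (simp add: cstar_scaleR)
qed

text \<open>After division by \<open>M\<close>, both \<open>1 - (p - q) = (1 - p) + q\<close> and
  \<open>1 + (p - q) = (1 - q) + p\<close> are sums of positive elements.\<close>

lemma norm_diff_positive_le_unital: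
  fixes b c :: "'a::{cstar_algebra,real_normed_algebra_1}"
  assumes "norm (cstar b * b) \<le> M" "norm (cstar c * c) \<le> M" "0 < M"
  shows "norm (cstar b * b - cstar c * c) \<le> M"
proof -
  define p where "p = (1/M) *\<^sub>R (cstar b * b)"
  define q where "q = (1/M) *\<^sub>R (cstar c * c)"
  have p: "sq_pos p" "norm p \<le> 1" and q: "sq_pos q" "norm q \<le> 1"
    using assms by (auto simp: p_def q_def intro!: sq_pos_scaleR sq_pos_cstar_mult_self)
  have "norm (p - q) \<le> 1"
  proof (rule norm_le_one_if_between)
    show "sq_pos (1 - (p - q))" using sq_pos_add[OF sq_pos_one_minus[OF p] q(1)] by (simp add: algebra_simps)
    show "sq_pos (1 + (p - q))" using sq_pos_add[OF sq_pos_one_minus[OF q] p(1)] by (simp add: algebra_simps)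
  qed
  moreover have "p - q = (1/M) *\<^sub>R (cstar b * b - cstar c * c)"
    by (simp add: p_def q_def scaleR_diff_right)
  ultimately show ?thesis using assms(3) by simp
qed

section \<open>The unitization\<close>

text \<open>The first component of the maximum in the norm is only a seminorm if the algebra already has
  a unit; taking the modulus of the scalar part into account repairs this.\<close>

datatype 'a unitization = Unitization (elt: 'a) (scl: complex)

text \<open>Left multiplication by \<open>u\<close> on the original algebra, which sits in the
  unitization as an ideal.\<close>

definition mult_op :: "'a::cstar_algebra unitization \<Rightarrow> 'a \<Rightarrow> 'a" where
  "mult_op u w = elt u * w + cscale (scl u) w"

lemma bounded_linear_cscale: "bounded_linear (cscale c :: 'a::cstar_algebra \<Rightarrow> 'a)"
  by (rule bounded_linear_intro[where K="cmod c"])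
    (simp_all add: cscale_add_right cscale_scaleR norm_cscale mult.commute)

lemma bounded_linear_mult_op: "bounded_linear (mult_op u)"
  unfolding mult_op_def
  by (intro bounded_linear_add bounded_linear_mult_right bounded_linear_cscale)

lemma onorm_mult_op_le: "onorm (mult_op u) \<le> norm (elt u) + cmod (scl u)"
proof (rule onorm_bound)
  fix w :: 'a
  have "norm (mult_op u w) \<le> norm (elt u * w) + norm (cscale (scl u) w)"
    unfolding mult_op_def by (rule norm_triangle_ineq)
  also have "\<dots> \<le> (norm (elt u) + cmod (scl u)) * norm w"
    by (simp add: norm_cscale distrib_right norm_mult_ineq)
  finally show "norm (mult_op u w) \<le> (norm (elt u) + cmod (scl u)) * norm w" .
qed simp

text \<open>The lower bound comes from testing on \<open>cstar a\<close>, by the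
  C*-identity.\<close>

lemma onorm_mult_op_embed:
  "onorm (mult_op (Unitization (a::'a::cstar_algebra) 0)) = norm a"
proof (rule antisym)
  show "onorm (mult_op (Unitization a 0)) \<le> norm a"
    using onorm_mult_op_le[of "Unitization a 0"] by simp
  show "norm a \<le> onorm (mult_op (Unitization a 0))"
  proof (cases "a = 0")
    case True
    then show ?thesis using onorm_pos_le[OF bounded_linear_mult_op] by simp
  next
    case False
    have "norm a * norm a = norm (mult_op (Unitization a 0) (cstar a))"
      using norm_cstar_mult_self[of "cstar a"] by (simp add: mult_op_def cstar_cstar)
    also have "\<dots> \<le> onorm (mult_op (Unitization a 0)) * norm a"
      using onorm[OF bounded_linear_mult_op, of "Unitization a 0" "cstar a"] by simp
    finally show ?thesis using False by simp
  qed
qed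

instantiation unitization :: (cstar_algebra) real_vector
begin

definition zero_unitization :: "'a unitization" where
  "0 = Unitization 0 0"
definition plus_unitization :: "'a unitization \<Rightarrow> 'a unitization \<Rightarrow> 'a unitization" where
  "u + v = Unitization (elt u + elt v) (scl u + scl v)"
definition minus_unitization :: "'a unitization \<Rightarrow> 'a unitization \<Rightarrow> 'a unitization" where
  "u - v = Unitization (elt u - elt v) (scl u - scl v)"
definition uminus_unitization :: "'a unitization \<Rightarrow> 'a unitization" where
  "- u = Unitization (- elt u) (- scl u)"
definition scaleR_unitization :: "real \<Rightarrow> 'a unitization \<Rightarrow> 'a unitization" where
  "r *\<^sub>R u = Unitization (r *\<^sub>R elt u) (r *\<^sub>R scl u)"
lemma elt_simps [simp]:
  "elt (0::'a unitization) = 0" "elt (u + v) = elt u + elt v" "elt (u - v) = elt u - elt v"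
  "elt (- u) = - elt u" "elt (r *\<^sub>R u) = r *\<^sub>R elt u"
  for u v :: "'a unitization"
  by (simp_all add: zero_unitization_def plus_unitization_def minus_unitization_def
      uminus_unitization_def scaleR_unitization_def)

lemma scl_simps [simp]:
  "scl (0::'a unitization) = 0" "scl (u + v) = scl u + scl v" "scl (u - v) = scl u - scl v"
  "scl (- u) = - scl u" "scl (r *\<^sub>R u) = r *\<^sub>R scl u"
  for u v :: "'a unitization"
  by (simp_all add: zero_unitization_def plus_unitization_def minus_unitization_def
      uminus_unitization_def scaleR_unitization_def)

instance
  by standard (auto intro!: unitization.expand simp: algebra_simps)

end

instantiation unitization :: (cstar_algebra) real_normed_vector
begin

definition norm_unitization :: "'a unitization \<Rightarrow> real" where
  "norm u = max (onorm (mult_op u)) (cmod (scl u))"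
definition sgn_unitization :: "'a unitization \<Rightarrow> 'a unitization" where
  "sgn (u :: 'a unitization) = u /\<^sub>R norm u"
definition dist_unitization :: "'a unitization \<Rightarrow> 'a unitization \<Rightarrow> real" where
  "dist (u :: 'a unitization) v = norm (u - v)"
definition uniformity_unitization :: "('a unitization \<times> 'a unitization) filter" where
  "uniformity = (INF e\<in>{0 <..}. principal {(u, v :: 'a unitization). dist u v < e})"
definition open_unitization :: "'a unitization set \<Rightarrow> bool" where
  "open (U :: 'a unitization set) \<longleftrightarrow> (\<forall>u\<in>U. eventually (\<lambda>(u', v). u' = u \<longrightarrow> v \<in> U) uniformity)"

instance
proof
  fix u v :: "'a unitization" and r :: real
  show "(norm u = 0) = (u = 0)"
  proof
    assume n: "norm u = 0"
    then have "cmod (scl u) \<le> 0" unfolding norm_unitization_def by (metis max.cobounded2)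
    then have s: "scl u = 0" by simp
    have "onorm (mult_op u) \<le> 0" using n unfolding norm_unitization_def by (metis max.cobounded1)
    \<comment> \<open>With zero scalar part, \<open>u\<close> lies in the embedded algebra, where
      the operator norm is the original norm.\<close>
    moreover have "u = Unitization (elt u) 0" using s by (metis unitization.collapse)
    ultimately have "norm (elt u) \<le> 0" using onorm_mult_op_embed by metis
    with s show "u = 0" by (simp add: unitization.expand)
  next
    assume "u = 0"
    then show "norm u = 0"
      by (simp add: norm_unitization_def mult_op_def[abs_def] onorm_zero)
  qed
  have op: "mult_op (u + v) = (\<lambda>w. mult_op u w + mult_op v w)"
    by (auto simp: mult_op_def fun_eq_iff algebra_simps cscale_add_left)
  show "norm (u + v) \<le> norm u + norm v"
    using onorm_triangle[OF bounded_linear_mult_op[of u] bounded_linear_mult_op[of v]]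
      norm_triangle_ineq[of "scl u" "scl v"]
    unfolding norm_unitization_def op by (auto simp: max_def)
  have "mult_op (r *\<^sub>R u) = (\<lambda>w. r *\<^sub>R mult_op u w)"
    by (auto simp: mult_op_def fun_eq_iff scaleR_conv_of_real cscale_add_right cscale_mult_left
        simp flip: cscale_of_real cscale_cscale)
  then show "norm (r *\<^sub>R u) = \<bar>r\<bar> * norm u"
    using onorm_scaleR[OF bounded_linear_mult_op[of u], of r]
    unfolding norm_unitization_def by (simp add: max_mult_distrib_left)
qed (rule sgn_unitization_def dist_unitization_def uniformity_unitization_def open_unitization_def)+

end

section \<open>Component estimates and completeness\<close>

lemma norm_scl_le: "cmod (scl u) \<le> norm u"
  by (simp add: norm_unitization_def)

lemma norm_embed [simp]: "norm (Unitization a 0) = norm a"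
  by (simp add: norm_unitization_def onorm_mult_op_embed)

lemma norm_unitization_le: "norm u \<le> norm (elt u) + cmod (scl u)"
  using onorm_mult_op_le[of u] by (simp add: norm_unitization_def)

text \<open>Subtract the scalar part, whose norm is at most \<open>norm u\<close>. Cauchy sequences
  therefore have Cauchy components.\<close>

lemma norm_elt_le: "norm (elt u) \<le> 2 * norm u"
proof -
  have e: "Unitization (elt u) 0 = u - Unitization 0 (scl u)"
    by (intro unitization.expand) simp
  have "norm (elt u) = norm (u - Unitization 0 (scl u))"
    unfolding e[symmetric] by simp
  also have "\<dots> \<le> norm u + norm (Unitization (0::'a) (scl u))" by (rule norm_triangle_ineq4)
  also have "\<dots> \<le> 2 * norm u"
    using norm_unitization_le[of "Unitization (0::'a) (scl u)"] norm_scl_le[of u] by simp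
  finally show ?thesis .
qed

instance unitization :: (cstar_algebra) banach
proof
  fix X :: "nat \<Rightarrow> 'a unitization"
  assume X: "Cauchy X"
  have "Cauchy (\<lambda>n. elt (X n))"
  proof (rule CauchyI)
    fix e :: real assume "0 < e"
    then obtain M where M: "\<And>m n. m \<ge> M \<Longrightarrow> n \<ge> M \<Longrightarrow> norm (X m - X n) < e / 2"
      using CauchyD[OF X, of "e/2"] by auto
    have "norm (elt (X m) - elt (X n)) < e" if "m \<ge> M" "n \<ge> M" for m n
      using norm_elt_le[of "X m - X n"] M[OF that] by simp
    then show "\<exists>M. \<forall>m\<ge>M. \<forall>n\<ge>M. norm (elt (X m) - elt (X n)) < e" by blast
  qed
  then obtain a where a: "(\<lambda>n. elt (X n)) \<longlonglongrightarrow> a"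
    using Cauchy_convergent_iff convergent_def by blast
  have "Cauchy (\<lambda>n. scl (X n))"
  proof (rule CauchyI)
    fix e :: real assume "0 < e"
    then obtain M where M: "\<And>m n. m \<ge> M \<Longrightarrow> n \<ge> M \<Longrightarrow> norm (X m - X n) < e"
      using CauchyD[OF X] by blast
    have "norm (scl (X m) - scl (X n)) < e" if "m \<ge> M" "n \<ge> M" for m n
      using norm_scl_le[of "X m - X n"] M[OF that] by simp
    then show "\<exists>M. \<forall>m\<ge>M. \<forall>n\<ge>M. norm (scl (X m) - scl (X n)) < e" by blast
  qed
  then obtain l where l: "(\<lambda>n. scl (X n)) \<longlonglongrightarrow> l"
    using Cauchy_convergent_iff convergent_def by blast
  have "(\<lambda>n. norm (elt (X n) - a) + cmod (scl (X n) - l)) \<longlonglongrightarrow> 0 + 0"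
    by (intro tendsto_add tendsto_norm_zero LIM_zero a l)
  then have lim: "(\<lambda>n. norm (elt (X n) - a) + cmod (scl (X n) - l)) \<longlonglongrightarrow> 0" by simp
  have "\<forall>n. norm (X n - Unitization a l) \<le> norm (elt (X n) - a) + cmod (scl (X n) - l)"
  proof
    show "norm (X n - Unitization a l) \<le> norm (elt (X n) - a) + cmod (scl (X n) - l)" for n
      using norm_unitization_le[of "X n - Unitization a l"] by simp
  qed
  then have "(\<lambda>n. X n - Unitization a l) \<longlonglongrightarrow> 0"
    by (rule Lim_null_comparison[OF always_eventually lim])
  then show "convergent X"
    unfolding convergent_def using LIM_zero_cancel by blast
qed

section \<open>The C*-structure of the unitization\<close>

instantiation unitization :: (cstar_algebra) "{cstar_algebra, real_normed_algebra_1}"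
begin

definition one_unitization :: "'a unitization" where
  "1 = Unitization 0 1"
definition times_unitization :: "'a unitization \<Rightarrow> 'a unitization \<Rightarrow> 'a unitization" where
  "u * v = Unitization (elt u * elt v + cscale (scl u) (elt v) + cscale (scl v) (elt u)) (scl u * scl v)"
definition cscale_unitization :: "complex \<Rightarrow> 'a unitization \<Rightarrow> 'a unitization" where
  "cscale c u = Unitization (cscale c (elt u)) (c * scl u)"
definition cstar_unitization :: "'a unitization \<Rightarrow> 'a unitization" where
  "cstar u = Unitization (cstar (elt u)) (cnj (scl u))"

lemma elt_alg_simps [simp]:
  "elt (1::'a unitization) = 0" "elt (cscale c u) = cscale c (elt u)" "elt (cstar u) = cstar (elt u)"
  "elt (u * v) = elt u * elt v + cscale (scl u) (elt v) + cscale (scl v) (elt u)"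
  for u v :: "'a unitization"
  by (simp_all add: one_unitization_def times_unitization_def cscale_unitization_def
      cstar_unitization_def)

lemma scl_alg_simps [simp]:
  "scl (1::'a unitization) = 1" "scl (cscale c u) = c * scl u" "scl (cstar u) = cnj (scl u)"
  "scl (u * v) = scl u * scl v"
  for u v :: "'a unitization"
  by (simp_all add: one_unitization_def times_unitization_def cscale_unitization_def
      cstar_unitization_def)

lemma mult_op_mult: "mult_op (u * v) = mult_op u \<circ> mult_op v" for u v :: "'a unitization"
  by (simp add: fun_eq_iff mult_op_def algebra_simps cscale_add_right cscale_mult_left
      cscale_mult_right cscale_cscale)

lemma onorm_mult_op_cstar_mult:
  "onorm (mult_op (cstar u * u)) = (onorm (mult_op u))\<^sup>2" for u :: "'a unitization"
proof -
  have submult: "onorm (mult_op (cstar u * u)) \<le> onorm (mult_op (cstar u)) * onorm (mult_op u)" for u :: "'a unitization"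
    unfolding mult_op_mult by (intro onorm_compose bounded_linear_mult_op)
  have sq: "(onorm (mult_op u))\<^sup>2 \<le> onorm (mult_op (cstar u * u))" for u :: "'a unitization"
  proof -
    define K where "K = onorm (mult_op (cstar u * u))"
    have K: "0 \<le> K" unfolding K_def by (intro onorm_pos_le bounded_linear_mult_op)
    have "onorm (mult_op u) \<le> sqrt K"
    proof (rule onorm_bound)
      fix w :: 'a
      have "cstar (mult_op u w) * mult_op u w = cstar w * mult_op (cstar u) (mult_op u w)"
        by (simp add: mult_op_def cstar_add cstar_mult cstar_cscale cscale_mult_left
            cscale_mult_right cscale_add_right cscale_cscale algebra_simps)
      also have "\<dots> = cstar w * mult_op (cstar u * u) w" by (simp add: mult_op_mult)
      finally have "(norm (mult_op u w))\<^sup>2 \<le> norm w * norm (mult_op (cstar u * u) w)"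
        using norm_mult_ineq[of "cstar w" "mult_op (cstar u * u) w"]
        by (simp flip: cstar_identity)
      also have "\<dots> \<le> norm w * (K * norm w)"
        unfolding K_def by (intro mult_left_mono onorm bounded_linear_mult_op) simp
      also have "\<dots> = (sqrt K * norm w)\<^sup>2"
        using K by (simp add: power2_eq_square)
      finally show "norm (mult_op u w) \<le> sqrt K * norm w"
        by (rule power2_le_imp_le) (use K in simp)
    qed (use K in simp)
    then show ?thesis
      unfolding K_def[symmetric] using K onorm_pos_le[OF bounded_linear_mult_op, of u]
      by (metis power_mono real_sqrt_pow2)
  qed
  have le: "onorm (mult_op u) \<le> onorm (mult_op (cstar u))" for u :: "'a unitization"
  proof (cases "onorm (mult_op u) = 0")
    case True
    then show ?thesis using onorm_pos_le[OF bounded_linear_mult_op] by metis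
  next
    case False
    then show ?thesis
      using order_trans[OF sq[of u] submult] onorm_pos_le[OF bounded_linear_mult_op, of u]
      by (simp add: power2_eq_square)
  qed
  have "cstar (cstar u) = u" by (intro unitization.expand) (simp add: cstar_cstar)
  then have "onorm (mult_op (cstar u)) = onorm (mult_op u)"
    using le[of u] le[of "cstar u"] by simp
  then show ?thesis using sq[of u] submult[of u] by (simp add: power2_eq_square)
qed

instance
proof
  fix u v w :: "'a unitization" and c d :: complex and r :: real
  show "cscale c (u + v) = cscale c u + cscale c v"
    by (intro unitization.expand) (simp add: cscale_add_right algebra_simps)
  show "cscale (c + d) u = cscale c u + cscale d u"
    by (intro unitization.expand) (simp add: cscale_add_left algebra_simps)
  show "cscale c (cscale d u) = cscale (c * d) u"
    by (intro unitization.expand) (simp add: cscale_cscale)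
  show "cscale 1 u = u"
    by (intro unitization.expand) (simp add: cscale_one)
  show "r *\<^sub>R u = cscale (complex_of_real r) u"
    by (intro unitization.expand) (simp add: scaleR_cscale scaleR_conv_of_real)
  show "(u * v) * w = u * (v * w)"
    by (intro unitization.expand) (simp add: algebra_simps cscale_add_right cscale_mult_left
      cscale_mult_right cscale_cscale)
  show "(u + v) * w = u * w + v * w" "u * (v + w) = u * v + u * w"
    by (intro unitization.expand; simp add: algebra_simps cscale_add_right cscale_add_left)+
  show "r *\<^sub>R u * v = r *\<^sub>R (u * v)" "u * r *\<^sub>R v = r *\<^sub>R (u * v)"
    by (intro unitization.expand; simp add: scaleR_cscale scaleR_conv_of_real cscale_add_right
      cscale_mult_left cscale_mult_right cscale_cscale mult.commute mult.left_commute)+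
  show "1 * u = u" "u * 1 = u"
    by (intro unitization.expand; simp add: cscale_one)+
  show "(0::'a unitization) \<noteq> 1"
    by (metis scl_simps(1) scl_alg_simps(1) zero_neq_one)
  have "onorm (mult_op (u * v)) \<le> onorm (mult_op u) * onorm (mult_op v)"
    unfolding mult_op_mult by (intro onorm_compose bounded_linear_mult_op)
  also have "\<dots> \<le> norm u * norm v"
    unfolding norm_unitization_def
    by (intro mult_mono) (auto intro: onorm_pos_le bounded_linear_mult_op simp: le_max_iff_disj)
  finally show "norm (u * v) \<le> norm u * norm v"
    using mult_mono[OF norm_scl_le[of u] norm_scl_le[of v]]
    by (simp add: norm_unitization_def[of "u * v"] norm_mult)
  show "norm (1::'a unitization) = 1"
    using norm_unitization_le[of "1::'a unitization"] norm_scl_le[of "1::'a unitization"] by simp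
  have "mult_op (cscale c u) = cscale c \<circ> mult_op u"
    by (simp add: fun_eq_iff mult_op_def cscale_mult_left cscale_add_right cscale_cscale)
  then have sc: "onorm (mult_op (cscale c u)) = cmod c * onorm (mult_op u)"
    using onorm_scaleR[OF bounded_linear_mult_op[of u], of "cmod c"]
    by (simp add: onorm_def norm_cscale)
  show "norm (cscale c u) = cmod c * norm u"
    unfolding norm_unitization_def sc by (simp add: norm_mult max_mult_distrib_left)
  show "cscale c u * v = cscale c (u * v)" "u * cscale c v = cscale c (u * v)"
    by (intro unitization.expand; simp add: cscale_add_right
      cscale_mult_left cscale_mult_right cscale_cscale mult.commute mult.left_commute)+
  show "cstar (u + v) = cstar u + cstar v"
    by (intro unitization.expand) (simp add: cstar_add)
  show "cstar (cscale c u) = cscale (cnj c) (cstar u)"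
    by (intro unitization.expand) (simp add: cstar_cscale)
  show "cstar (u * v) = cstar v * cstar u"
    by (intro unitization.expand) (simp add: cstar_add cstar_mult cstar_cscale)
  show "cstar (cstar u) = u"
    by (intro unitization.expand) (simp add: cstar_cstar)
  have sq: "cmod (scl (cstar u * u)) = (cmod (scl u))\<^sup>2" by (simp add: norm_mult power2_eq_square)
  have max_sq: "max (p\<^sup>2) (q\<^sup>2) = (max p q)\<^sup>2" if "0 \<le> p" "0 \<le> q" for p q :: real
    using that by (cases "p \<le> q") (simp_all add: max_absorb1 max_absorb2 power_mono)
  show "norm (cstar u * u) = (norm u)\<^sup>2"
    unfolding norm_unitization_def onorm_mult_op_cstar_mult sq
    by (rule max_sq[OF onorm_pos_le[OF bounded_linear_mult_op] norm_ge_zero])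
qed

end

text \<open>Transfer along the isometric *-embedding into the unitization.\<close>

lemma norm_diff_positive_le:
  fixes b c :: "'a::cstar_algebra"
  assumes "norm (cstar b * b) \<le> M" "norm (cstar c * c) \<le> M" "0 < M"
  shows "norm (cstar b * b - cstar c * c) \<le> M"
proof -
  have emb: "cstar (Unitization d 0) * Unitization d 0 = Unitization (cstar d * d) 0" for d :: 'a
    by (intro unitization.expand) simp
  have "Unitization (cstar b * b - cstar c * c) 0 = Unitization (cstar b * b) 0 - Unitization (cstar c * c) 0"
    by (intro unitization.expand) simp
  then show ?thesis
    using norm_diff_positive_le_unital[of "Unitization b 0" M "Unitization c 0"] assms
    by (metis emb norm_embed)
qed

section \<open>Sublinear functionals and the Hahn--Banach theorem\<close>

definition sublinear :: "('v::real_vector \<Rightarrow> real) \<Rightarrow> bool" where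
  "sublinear p \<longleftrightarrow> (\<forall>x y. p (x + y) \<le> p x + p y) \<and> (\<forall>r x. 0 \<le> r \<longrightarrow> p (r *\<^sub>R x) = r * p x)"

lemma sublinear_add: "sublinear p \<Longrightarrow> p (x + y) \<le> p x + p y"
  and sublinear_scaleR: "sublinear p \<Longrightarrow> 0 \<le> r \<Longrightarrow> p (r *\<^sub>R x) = r * p x"
  by (auto simp: sublinear_def)

lemma sublinear_zero: "sublinear p \<Longrightarrow> p 0 = 0"
  using sublinear_scaleR[of p 0 0] by simp

lemma sublinear_minus: "sublinear p \<Longrightarrow> - p (- x) \<le> p x"
  using sublinear_add[of p x "- x"] by (simp add: sublinear_zero)

lemma sublinear_norm: "sublinear (norm :: 'v::real_normed_vector \<Rightarrow> real)"
  by (simp add: sublinear_def norm_triangle_ineq)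

lemma sublinearI:
  assumes add: "\<And>x y. p (x + y) \<le> p x + p y"
    and scale: "\<And>r x. 0 < r \<Longrightarrow> p (r *\<^sub>R x) \<le> r * p x"
    and zero: "p 0 = 0"
  shows "sublinear p"
  unfolding sublinear_def
proof (intro conjI allI impI add)
  fix r :: real and x assume "0 \<le> r"
  show "p (r *\<^sub>R x) = r * p x"
  proof (cases "r = 0")
    case False
    with \<open>0 \<le> r\<close> have r: "0 < r" by simp
    \<comment> \<open>The reverse inequality is the assumed one for the factor
      \<open>1/r\<close>.\<close>
    have "r * p ((1/r) *\<^sub>R (r *\<^sub>R x)) \<le> r * ((1/r) * p (r *\<^sub>R x))"
      using r by (intro mult_left_mono scale) auto
    then show ?thesis using scale[OF r, of x] r by simp
  qed (simp add: zero)
qed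

text \<open>The right derivative of \<open>p\<close> at \<open>a\<close> in direction \<open>x\<close>, with the increment \<open>1 / t\<close>.\<close>
definition dir_deriv :: "('v::real_vector \<Rightarrow> real) \<Rightarrow> 'v \<Rightarrow> 'v \<Rightarrow> real" where
  "dir_deriv p a x = (INF t\<in>{0..}. p (x + t *\<^sub>R a) - t * p a)"

text \<open>The bound is independent of \<open>t\<close>, so the real infimum in
  \<open>dir_deriv\<close> is over a set bounded below.\<close>

lemma dir_deriv_bound:
  assumes "sublinear p" "0 \<le> t"
  shows "- p (- x) \<le> p (x + t *\<^sub>R a) - t * p a"
  using sublinear_add[OF assms(1), of "x + t *\<^sub>R a" "- x"] sublinear_scaleR[OF assms, of a] by simp

lemma dir_deriv_le:
  assumes "sublinear p" "0 \<le> t"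
  shows "dir_deriv p a x \<le> p (x + t *\<^sub>R a) - t * p a"
  unfolding dir_deriv_def using assms
  by (intro cINF_lower bdd_belowI2[where m="- p (- x)"] dir_deriv_bound) auto

lemma dir_deriv_greatest:
  "(\<And>t. 0 \<le> t \<Longrightarrow> m \<le> p (x + t *\<^sub>R a) - t * p a) \<Longrightarrow> m \<le> dir_deriv p a x"
  unfolding dir_deriv_def by (intro cINF_greatest) auto

lemma dir_deriv_le_self: "sublinear p \<Longrightarrow> dir_deriv p a x \<le> p x"
  using dir_deriv_le[of p 0 a x] by simp

lemma dir_deriv_minus_self: "sublinear p \<Longrightarrow> dir_deriv p a (- a) \<le> - p a"
  using dir_deriv_le[of p 1 a "- a"] by (simp add: sublinear_zero)

text \<open>Parameters \<open>s\<close> for \<open>x\<close> and \<open>t\<close> for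
  \<open>y\<close> combine to \<open>s + t\<close> for \<open>x + y\<close>; scaling
  \<open>x\<close> by \<open>r\<close> scales the parameter by \<open>r\<close>.\<close>

lemma sublinear_dir_deriv:
  assumes p: "sublinear p"
  shows "sublinear (dir_deriv p a)"
proof (rule sublinearI)
  fix x y
  have "dir_deriv p a (x + y) - (p (y + t *\<^sub>R a) - t * p a) \<le> dir_deriv p a x" if t: "0 \<le> t" for t
  proof (rule dir_deriv_greatest)
    fix s :: real assume s: "0 \<le> s"
    have "dir_deriv p a (x + y) \<le> p (x + y + (s + t) *\<^sub>R a) - (s + t) * p a"
      using s t by (intro dir_deriv_le p) simp
    also have "x + y + (s + t) *\<^sub>R a = (x + s *\<^sub>R a) + (y + t *\<^sub>R a)"
      by (simp add: algebra_simps)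
    finally show "dir_deriv p a (x + y) - (p (y + t *\<^sub>R a) - t * p a) \<le> p (x + s *\<^sub>R a) - s * p a"
      using sublinear_add[OF p, of "x + s *\<^sub>R a" "y + t *\<^sub>R a"] by (simp add: algebra_simps)
  qed
  then have "dir_deriv p a (x + y) - dir_deriv p a x \<le> dir_deriv p a y"
    by (intro dir_deriv_greatest) (simp add: algebra_simps)
  then show "dir_deriv p a (x + y) \<le> dir_deriv p a x + dir_deriv p a y" by simp
next
  fix r :: real and x assume r: "0 < r"
  have "dir_deriv p a (r *\<^sub>R x) / r \<le> dir_deriv p a x"
  proof (rule dir_deriv_greatest)
    fix t :: real assume t: "0 \<le> t"
    have "dir_deriv p a (r *\<^sub>R x) \<le> p (r *\<^sub>R x + (r * t) *\<^sub>R a) - (r * t) * p a"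
      using r t by (intro dir_deriv_le p) simp
    also have "r *\<^sub>R x + (r * t) *\<^sub>R a = r *\<^sub>R (x + t *\<^sub>R a)" by (simp add: algebra_simps)
    also have "p (r *\<^sub>R (x + t *\<^sub>R a)) = r * p (x + t *\<^sub>R a)"
      using r by (intro sublinear_scaleR p) simp
    finally show "dir_deriv p a (r *\<^sub>R x) / r \<le> p (x + t *\<^sub>R a) - t * p a"
      using r by (simp add: field_simps)
  qed
  then show "dir_deriv p a (r *\<^sub>R x) \<le> r * dir_deriv p a x"
    using r by (simp add: field_simps)
next
  show "dir_deriv p a 0 = 0"
  proof (rule antisym)
    show "dir_deriv p a 0 \<le> 0" using dir_deriv_le_self[OF p, of a 0] by (simp add: sublinear_zero p)
    show "0 \<le> dir_deriv p a 0"
      by (rule dir_deriv_greatest) (simp add: sublinear_scaleR p)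
  qed
qed

text \<open>Zorn's lemma for the pointwise order; the pointwise infimum of a chain is a lower
  bound.\<close>

lemma exists_minimal_sublinear:
  fixes p :: "'v::real_vector \<Rightarrow> real"
  assumes p: "sublinear p"
  obtains m where "sublinear m" "m \<le> p" "\<And>q. sublinear q \<Longrightarrow> q \<le> m \<Longrightarrow> q = m"
proof -
  define A where "A = {q. sublinear q \<and> q \<le> p}"
  \<comment> \<open>Reversed, since Zorn's lemma delivers maximal elements.\<close>
  define R where "R = (\<lambda>q q' :: 'v \<Rightarrow> real. q' \<le> q)"
  have "\<exists>m\<in>A. \<forall>a\<in>A. R m a \<longrightarrow> a = m"
  proof (rule predicate_Zorn)
    show "partial_order_on A (relation_of R A)"
      by (rule partial_order_on_relation_ofI) (auto simp: R_def)
  next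
    fix C assume C: "C \<in> Chains (relation_of R A)"
    have CA: "C \<subseteq> A" and total: "\<And>q q'. q \<in> C \<Longrightarrow> q' \<in> C \<Longrightarrow> q \<le> q' \<or> q' \<le> q"
      using C unfolding Chains_def relation_of_def R_def by auto
    show "\<exists>u\<in>A. \<forall>a\<in>C. R a u"
    proof (cases "C = {}")
      case True
      then show ?thesis using p by (auto simp: A_def)
    next
      case False
      define u where "u = (\<lambda>x. INF q\<in>C. q x)"
      have bound: "- p (- x) \<le> q x" if "q \<in> C" for q x
      proof -
        have "sublinear q" "q (- x) \<le> p (- x)" using that CA by (auto simp: A_def le_fun_def)
        then show ?thesis using sublinear_minus[of q x] by simp
      qed
      have lower: "u x \<le> q x" if "q \<in> C" for q x
        unfolding u_def using that bound by (intro cINF_lower bdd_belowI2) auto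
      have greatest: "m \<le> u x" if "\<And>q. q \<in> C \<Longrightarrow> m \<le> q x" for m x
        unfolding u_def using that False by (intro cINF_greatest) auto
      have sub: "sublinear q" if "q \<in> C" for q using that CA by (auto simp: A_def)
      have "sublinear u"
      proof (rule sublinearI)
        fix x y
        \<comment> \<open>Of two members of the chain, the smaller one is subadditive and lies below
          both.\<close>
        have "u (x + y) \<le> q1 x + q2 y" if q: "q1 \<in> C" "q2 \<in> C" for q1 q2
          using total[OF q] lower[OF q(1), of "x + y"] lower[OF q(2), of "x + y"]
            sublinear_add[OF sub[OF q(1)], of x y] sublinear_add[OF sub[OF q(2)], of x y]
          unfolding le_fun_def by (smt (verit))
        then have "u (x + y) - q2 y \<le> u x" if "q2 \<in> C" for q2
          using that by (intro greatest) (simp add: algebra_simps)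
        then have "u (x + y) - u x \<le> u y"
          by (intro greatest) (simp add: algebra_simps)
        then show "u (x + y) \<le> u x + u y" by simp
      next
        fix r :: real and x assume r: "0 < r"
        have "u (r *\<^sub>R x) / r \<le> u x"
          using r lower[of _ "r *\<^sub>R x"] sub
          by (intro greatest) (simp add: sublinear_scaleR field_simps)
        then show "u (r *\<^sub>R x) \<le> r * u x" using r by (simp add: field_simps)
      next
        show "u 0 = 0" using False sub by (simp add: u_def sublinear_zero)
      qed
      moreover have "u \<le> p"
      proof (rule le_funI)
        fix x
        obtain q where q: "q \<in> C" using False by blast
        then have "q x \<le> p x" using CA by (auto simp: A_def le_fun_def)
        then show "u x \<le> p x" using lower[OF q, of x] by simp
      qed
      ultimately show ?thesis using lower by (auto simp: A_def R_def le_fun_def)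
    qed
  qed
  then show ?thesis using that by (auto simp: A_def R_def intro: order_trans)
qed

text \<open>A minimal sublinear functional coincides with all its directional derivatives and is therefore
  odd, hence linear.\<close>
lemma Hahn_Banach_dominated:
  assumes "sublinear p"
  obtains f where "linear f" "\<And>v. f v \<le> p v"
proof -
  obtain m where m: "sublinear m" "m \<le> p" and min: "\<And>q. sublinear q \<Longrightarrow> q \<le> m \<Longrightarrow> q = m"
    using exists_minimal_sublinear[OF assms] by metis
  have "dir_deriv m a = m" for a
    using dir_deriv_le_self[OF m(1)] by (intro min sublinear_dir_deriv m) (simp add: le_fun_def)
  then have "m (- a) \<le> - m a" for a using dir_deriv_minus_self[OF m(1), of a] by simp
  then have odd: "m (- a) = - m a" for a using sublinear_minus[OF m(1), of a] by (smt (verit))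
  have "linear m"
  proof (rule linearI)
    show "m (x + y) = m x + m y" for x y
      using sublinear_add[OF m(1), of x y] sublinear_add[OF m(1), of "- x" "- y"]
        odd[of x] odd[of y] odd[of "x + y"] by simp
    show "m (r *\<^sub>R x) = r *\<^sub>R m x" for r x
    proof (cases "0 \<le> r")
      case False
      then show ?thesis
        using sublinear_scaleR[OF m(1), of "- r" x] odd[of "r *\<^sub>R x"] by simp
    qed (simp add: sublinear_scaleR m)
  qed
  then show ?thesis using that m(2) by (auto simp: le_fun_def)
qed

text \<open>Dominating by \<open>dir_deriv p b\<close> instead of \<open>p\<close> forces
  \<open>f (- b) \<le> - p b\<close>, hence equality at \<open>b\<close>.\<close>

lemma Hahn_Banach_attaining:
  assumes "sublinear p"
  obtains f where "linear f" "\<And>v. f v \<le> p v" "f b = p b"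
proof -
  obtain f where f: "linear f" "\<And>v. f v \<le> dir_deriv p b v"
    using Hahn_Banach_dominated[OF sublinear_dir_deriv[OF assms]] by metis
  have le: "f v \<le> p v" for v using f(2)[of v] dir_deriv_le_self[OF assms, of b v] by simp
  have "- f b \<le> - p b"
    using f(2)[of "- b"] dir_deriv_minus_self[OF assms, of b] linear_neg[OF f(1), of b] by simp
  then show ?thesis using that f(1) le le[of b] by auto
qed

text \<open>Under \<open>t = 1/s\<close> the quotient is the term of the infimum at
  \<open>t\<close>. These terms decrease as \<open>t\<close> grows, so the infimum is the
  limit.\<close>

lemma tendsto_dir_deriv_norm:
  fixes a v :: "'v::real_normed_vector"
  shows "((\<lambda>s. (norm (a + s *\<^sub>R v) - norm a) / s) \<longlongrightarrow> dir_deriv norm a v) (at_right 0)"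
proof -
  have quot: "(norm (a + s *\<^sub>R v) - norm a) / s = norm (v + (1/s) *\<^sub>R a) - (1/s) * norm a"
    if "0 < s" for s
  proof -
    have "a + s *\<^sub>R v = s *\<^sub>R (v + (1/s) *\<^sub>R a)"
      using that by (simp add: scaleR_add_right)
    then have "norm (a + s *\<^sub>R v) = s * norm (v + (1/s) *\<^sub>R a)"
      using that by simp
    then show ?thesis using that by (simp add: diff_divide_distrib)
  qed
  show ?thesis
  proof (rule order_tendstoI)
    fix l assume l: "l < dir_deriv norm a v"
    have "l < (norm (a + s *\<^sub>R v) - norm a) / s" if "0 < s" for s
      using dir_deriv_le[OF sublinear_norm, of "1/s" a v] l that by (simp add: quot)
    then show "\<forall>\<^sub>F s in at_right 0. l < (norm (a + s *\<^sub>R v) - norm a) / s"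
      by (auto simp: eventually_at_right_field intro: exI[of _ 1])
  next
    fix l assume l: "dir_deriv norm a v < l"
    obtain t where t: "0 \<le> t" "norm (v + t *\<^sub>R a) - t * norm a < l"
      using dir_deriv_greatest[of l norm v a] l by (meson not_le)
    \<comment> \<open>One term below \<open>l\<close> keeps all later ones below;
      \<open>t + 1\<close> in place of \<open>t\<close> covers \<open>t = 0\<close>.\<close>
    have "(norm (a + s *\<^sub>R v) - norm a) / s < l" if s: "0 < s" "s < 1 / (t + 1)" for s
    proof -
      have "(t + 1) * s < 1" using s(2) t(1) by (simp add: field_simps)
      then have ts: "t \<le> 1/s" using s(1) by (simp add: field_simps)
      have "v + (1/s) *\<^sub>R a = (v + t *\<^sub>R a) + (1/s - t) *\<^sub>R a" by (simp add: algebra_simps)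
      then have "norm (v + (1/s) *\<^sub>R a) \<le> norm (v + t *\<^sub>R a) + (1/s - t) * norm a"
        using norm_triangle_ineq[of "v + t *\<^sub>R a" "(1/s - t) *\<^sub>R a"] ts
        by (simp add: add.assoc)
      then show ?thesis using t(2) s(1) by (simp add: quot algebra_simps)
    qed
    moreover have "0 < 1 / (t + 1)" using t(1) by simp
    ultimately show "\<forall>\<^sub>F s in at_right 0. (norm (a + s *\<^sub>R v) - norm a) / s < l"
      unfolding eventually_at_right_field by blast
  qed
qed

section \<open>States\<close>

text \<open>For linear \<open>f\<close>, the complex-linear functional that agrees with
  \<open>f\<close> on self-adjoint elements; elsewhere its real part may differ from
  \<open>f\<close>.\<close>

definition complexify :: "('a::cstar_algebra \<Rightarrow> real) \<Rightarrow> 'a \<Rightarrow> complex" where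
  "complexify f v = Complex (f (re_part v)) (f (im_part v))"

lemma re_part_add: "re_part (u + v) = re_part u + re_part v"
  by (simp add: re_part_def cstar_add algebra_simps)

lemma im_part_add: "im_part (u + v) = im_part u + im_part v"
  by (simp add: im_part_def cstar_add algebra_simps cscale_add_right cscale_diff_right)

lemma re_part_scaleR: "re_part (r *\<^sub>R v) = r *\<^sub>R re_part v"
  by (simp add: re_part_def cstar_scaleR algebra_simps)

lemma im_part_scaleR: "im_part (r *\<^sub>R v) = r *\<^sub>R im_part v"
  by (simp add: im_part_def cstar_scaleR cscale_scaleR cscale_diff_right algebra_simps)

lemma re_part_ii: "re_part (cscale \<i> v) = - im_part v"
  by (simp add: re_part_def im_part_def cstar_cscale cscale_minus_left cscale_add_right
      cscale_diff_right algebra_simps)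

lemma im_part_ii: "im_part (cscale \<i> v) = re_part v"
  by (simp add: re_part_def im_part_def cstar_cscale cscale_minus_left cscale_add_right
      cscale_diff_right algebra_simps)

lemma re_part_selfadjoint: "cstar v = v \<Longrightarrow> re_part v = v"
  by (simp add: re_part_def flip: scaleR_2)

lemma im_part_selfadjoint: "cstar v = v \<Longrightarrow> im_part v = 0"
  by (simp add: im_part_def)

lemma complexify_cscale:
  assumes "linear f"
  shows "complexify f (cscale c v) = c * complexify f v"
  by (subst cscale_Complex)
    (simp add: complexify_def complex_eq_iff re_part_add im_part_add re_part_scaleR im_part_scaleR
      re_part_ii im_part_ii linear_add[OF assms] linear_diff[OF assms]
      linear_scale[OF assms] linear_neg[OF assms])

lemma norm_complexify_le:
  assumes f: "linear f" and le: "\<And>v. f v \<le> norm v"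
  shows "cmod (complexify f v) \<le> norm v"
proof (cases "complexify f v = 0")
  case False
  \<comment> \<open>A phase that makes the value real and nonnegative, so that it equals
    \<open>f\<close> at a real part.\<close>
  define u where "u = cnj (sgn (complexify f v))"
  have u: "cmod u = 1" using False by (simp add: u_def norm_sgn)
  have "complexify f (cscale u v) = cmod (complexify f v)"
    using False unfolding complexify_cscale[OF f] u_def
    by (simp add: sgn_div_norm scaleR_conv_of_real complex_norm_square[symmetric]
        power2_eq_square field_simps)
  then have "cmod (complexify f v) = f (re_part (cscale u v))"
    by (metis Re_complex_of_real complexify_def complex.sel(1))
  also have "\<dots> \<le> norm (cscale u v)"
    using le norm_re_part order_trans by blast
  finally show ?thesis by (simp add: norm_cscale u)
qed simp

text \<open>If \<open>s p\<close> is a small positive element, then \<open>f (a - s p) \<le> \<parallel>a - s p\<parallel> \<le> \<parallel>a\<parallel> = f a\<close>.\<close>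
lemma norming_functional_nonneg:
  fixes b c :: "'a::cstar_algebra"
  assumes f: "linear f" and le: "\<And>v. f v \<le> norm v"
    and norming: "f (cstar b * b) = norm (cstar b * b)" and nz: "b \<noteq> 0"
  shows "0 \<le> f (cstar c * c)"
proof -
  define a where "a = cstar b * b"
  define p where "p = cstar c * c"
  have a: "0 < norm a" using nz by (simp add: a_def norm_cstar_mult_self)
  \<comment> \<open>Chosen so that \<open>s p\<close> has norm at most \<open>norm a\<close>; as
    \<open>s\<close> is positive, \<open>s p\<close> is again of the form
    \<open>c\<^sup>* c\<close>.\<close>
  define s where "s = norm a / (norm p + 1)"
  have s: "0 < s" using a by (simp add: s_def add_nonneg_pos)
  have sc: "cstar (sqrt s *\<^sub>R c) * (sqrt s *\<^sub>R c) = s *\<^sub>R p"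
    using s by (simp add: cstar_scaleR p_def)
  have "norm p / (norm p + 1) \<le> 1" by (simp add: divide_le_eq_1 add_nonneg_pos)
  then have "norm (s *\<^sub>R p) \<le> norm a"
    using mult_left_mono[of "norm p / (norm p + 1)" 1 "norm a"] s by (simp add: s_def)
  then have "norm (a - s *\<^sub>R p) \<le> norm a"
    using norm_diff_positive_le[of b "norm a" "sqrt s *\<^sub>R c"] a unfolding sc by (simp add: a_def)
  then have "f (a - s *\<^sub>R p) \<le> f a" using le[of "a - s *\<^sub>R p"] norming by (simp add: a_def)
  then have "0 \<le> s * f p" by (simp add: linear_diff[OF f] linear_scale[OF f])
  then show ?thesis using s by (simp add: p_def zero_le_mult_iff)
qed

lemma cstate_complexify:
  fixes b :: "'a::cstar_algebra"
  assumes f: "linear f" and le: "\<And>v. f v \<le> norm v"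
    and norming: "f (cstar b * b) = norm (cstar b * b)" and nz: "b \<noteq> 0"
  shows "cstate (complexify f)" "complexify f (cstar b * b) = norm (cstar b * b)"
proof -
  have sa: "complexify f (cstar c * c) = complex_of_real (f (cstar c * c))" for c
    by (simp add: complexify_def re_part_selfadjoint im_part_selfadjoint cstar_mult cstar_cstar
        linear_0[OF f] complex_of_real_def)
  show val: "complexify f (cstar b * b) = norm (cstar b * b)" by (simp add: sa norming)
  have bound: "cmod (complexify f v) \<le> norm v" for v
    by (rule norm_complexify_le[OF f le])
  have a: "0 < norm (cstar b * b)" using nz by (simp add: norm_cstar_mult_self)
  have "(SUP v\<in>{v. norm v \<le> 1}. cmod (complexify f v)) = 1"
  proof (rule antisym)
    show "(SUP v\<in>{v. norm v \<le> 1}. cmod (complexify f v)) \<le> 1"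
      using bound order_trans by (intro cSUP_least) (auto intro: exI[of _ 0])
    \<comment> \<open>The supremum 1 is attained at the normalized
      \<open>cstar b * b\<close>.\<close>
    define e where "e = cscale (complex_of_real (1 / norm (cstar b * b))) (cstar b * b)"
    have "cmod (complexify f e) = 1"
      using a unfolding e_def complexify_cscale[OF f] val by (simp add: norm_mult norm_divide)
    moreover have "norm e \<le> 1" using a by (simp add: e_def norm_cscale norm_divide)
    moreover have "bdd_above ((\<lambda>v. cmod (complexify f v)) ` {v. norm v \<le> 1})"
      using bound order_trans by (intro bdd_aboveI2[where M=1]) auto
    ultimately show "1 \<le> (SUP v\<in>{v. norm v \<le> 1}. cmod (complexify f v))"
      by (intro cSUP_upper2[of _ _ e]) auto
  qed
  moreover have "complexify f (u + v) = complexify f u + complexify f v" for u v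
    by (simp add: complexify_def complex_eq_iff re_part_add im_part_add linear_add[OF f])
  ultimately show "cstate (complexify f)"
    unfolding cstate_def
    using sa norming_functional_nonneg[OF f le norming nz] bound complexify_cscale[OF f]
    by (auto simp: cpos_def intro!: exI[of _ 1])
qed

text \<open>The boundedness clause of \<open>cstate\<close> makes its real supremum an upper bound;
  \<open>v\<close> is rescaled to norm one.\<close>

lemma cstate_norm_le:
  assumes "cstate \<psi>"
  shows "cmod (\<psi> v) \<le> norm v"
proof (cases "v = 0")
  case True
  have "\<psi> (0 + 0) = \<psi> 0 + \<psi> 0" using assms unfolding cstate_def by blast
  then show ?thesis using True by simp
next
  case False
  obtain K where K: "\<And>a. cmod (\<psi> a) \<le> K * norm a" using assms unfolding cstate_def by blast
  have "cmod (\<psi> a) \<le> \<bar>K\<bar>" if "norm a \<le> 1" for a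
  proof -
    have "K * norm a \<le> \<bar>K\<bar> * 1" using that by (intro mult_mono) auto
    then show ?thesis using K[of a] by simp
  qed
  then have "bdd_above ((\<lambda>a. cmod (\<psi> a)) ` {a. norm a \<le> 1})"
    by (intro bdd_aboveI2) auto
  then have "cmod (\<psi> (cscale (complex_of_real (1 / norm v)) v)) \<le> (SUP a\<in>{a. norm a \<le> 1}. cmod (\<psi> a))"
    using False by (intro cSUP_upper) (simp_all add: norm_cscale norm_divide)
  also have "\<dots> = 1" using assms unfolding cstate_def by blast
  also have "\<psi> (cscale (complex_of_real (1 / norm v)) v) = complex_of_real (1 / norm v) * \<psi> v"
    using assms unfolding cstate_def by blast
  finally show ?thesis using False by (simp add: norm_mult norm_divide field_simps)
qed

lemma cstate_Re_linear:
  assumes "cstate \<psi>"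
  shows "linear (\<lambda>v. Re (\<psi> v))"
proof (rule linearI)
  show "Re (\<psi> (u + v)) = Re (\<psi> u) + Re (\<psi> v)" for u v
    using assms by (simp add: cstate_def)
  show "Re (\<psi> (r *\<^sub>R v)) = r *\<^sub>R Re (\<psi> v)" for r v
    using assms by (simp add: cstate_def scaleR_cscale)
qed

section \<open>Norm derivatives in Hilbert modules\<close>

locale hilbert_module_ip =
  fixes act :: "'x::cvector \<Rightarrow> 'a::cstar_algebra \<Rightarrow> 'x" and ip :: "'x \<Rightarrow> 'x \<Rightarrow> 'a"
  assumes hm: "hilbert_module act ip"
begin

lemma ip_add_right: "ip x (y + z) = ip x y + ip x z"
  and ip_cscale_right: "ip x (cscale c y) = cscale c (ip x y)"
  and cstar_ip: "cstar (ip x y) = ip y x"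
  and cpos_ip_self: "cpos (ip x x)"
  and ip_self_eq_zero: "ip x x = 0 \<longleftrightarrow> x = 0"
  using hm by (simp_all add: hilbert_module_def)

lemma ip_add_left: "ip (x + y) z = ip x z + ip y z"
  by (metis cstar_add cstar_ip ip_add_right)

lemma ip_cscale_left: "ip (cscale c x) y = cscale (cnj c) (ip x y)"
  by (metis cstar_cscale cstar_ip ip_cscale_right)

lemma ip_zero_left: "ip 0 y = 0"
  using ip_cscale_left[of 0 0 y] by simp

lemma ip_self_add_scaleR:
  "ip (x + t *\<^sub>R y) (x + t *\<^sub>R y) = ip x x + t *\<^sub>R (ip x y + ip y x) + (t * t) *\<^sub>R ip y y"
  by (simp add: scaleR_cscale ip_add_left ip_add_right ip_cscale_left ip_cscale_right
      cscale_add_right cscale_cscale add.assoc)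

lemma hm_norm_sq: "(hm_norm ip x)\<^sup>2 = norm (ip x x)"
  by (simp add: hm_norm_def)

lemma Im_cstate_ip_self: "cstate \<psi> \<Longrightarrow> Im (\<psi> (ip x x)) = 0"
  using cpos_ip_self unfolding cstate_def by blast

text \<open>Polarization: \<open>\<psi>\<close> is real on \<open>\<langle>x + iy, x + iy\<rangle>\<close>.\<close>
lemma Re_cstate_ip_swap:
  assumes \<psi>: "cstate \<psi>"
  shows "Re (\<psi> (ip y x)) = Re (\<psi> (ip x y))"
proof -
  have add: "\<psi> (u + v) = \<psi> u + \<psi> v" and scale: "\<psi> (cscale c u) = c * \<psi> u" for u v c
    using \<psi> unfolding cstate_def by blast+
  have "ip (x + cscale \<i> y) (x + cscale \<i> y)
      = ip x x + ip y y + (cscale \<i> (ip x y) + cscale (- \<i>) (ip y x))"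
    by (simp add: ip_add_left ip_add_right ip_cscale_left ip_cscale_right cscale_cscale
        cscale_add_right cscale_one algebra_simps)
  then have "Im (\<psi> (ip x x + ip y y + (cscale \<i> (ip x y) + cscale (- \<i>) (ip y x)))) = 0"
    using Im_cstate_ip_self[OF \<psi>, of "x + cscale \<i> y"] by simp
  then show ?thesis
    by (simp add: add scale Im_cstate_ip_self[OF \<psi>])
qed

text \<open>Substituting \<open>t = - s\<close> gives a limit from the right in direction
  \<open>- b\<close>, and \<open>2 * t = - 2 * s\<close> accounts for the factor
  \<open>-1/2\<close>.\<close>

lemma tendsto_quotient_at_left:
  "((\<lambda>t::real. ((hm_norm ip (x + t *\<^sub>R y))\<^sup>2 - (hm_norm ip x)\<^sup>2) / (2 * t))
      \<longlongrightarrow> - (dir_deriv norm (ip x x) (- (ip x y + ip y x)) / 2)) (at_left 0)"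
proof -
  define a where "a = ip x x"
  define b where "b = ip x y + ip y x"
  define c where "c = ip y y"
  define Q where "Q s = (norm (a + s *\<^sub>R (- b)) - norm a) / s" for s
  define G where "G s = (norm (a + s *\<^sub>R (- b) + (s * s) *\<^sub>R c) - norm a) / s" for s
  have Q: "(Q \<longlongrightarrow> dir_deriv norm a (- b)) (at_right 0)"
    unfolding Q_def by (rule tendsto_dir_deriv_norm)
  have "((\<lambda>s. s * norm c) \<longlongrightarrow> 0 * norm c) (at_right 0)"
    by (intro tendsto_intros)
  then have lim: "((\<lambda>s. s * norm c) \<longlongrightarrow> 0) (at_right 0)" by simp
  \<comment> \<open>\<open>G\<close> contains the quadratic term \<open>(s * s) c\<close> and
    \<open>Q\<close> omits it; after division by \<open>s\<close> the difference is
    \<open>O(s)\<close>.\<close>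
  have bd: "norm (G s - Q s) \<le> s * norm c" if "0 < s" for s
  proof -
    have "G s - Q s = (norm (a + s *\<^sub>R (- b) + (s * s) *\<^sub>R c) - norm (a + s *\<^sub>R (- b))) / s"
      by (simp add: G_def Q_def diff_divide_distrib)
    moreover have "\<bar>norm (a + s *\<^sub>R (- b) + (s * s) *\<^sub>R c) - norm (a + s *\<^sub>R (- b))\<bar> \<le> s * s * norm c"
      using norm_triangle_ineq3[of "a + s *\<^sub>R (- b) + (s * s) *\<^sub>R c" "a + s *\<^sub>R (- b)"] that by simp
    ultimately have "\<bar>G s - Q s\<bar> \<le> s * s * norm c / s"
      using that by (simp only: abs_divide abs_of_pos divide_right_mono less_imp_le)
    then show ?thesis using that by simp
  qed
  have "eventually (\<lambda>s. norm (G s - Q s) \<le> s * norm c) (at_right 0)"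
    unfolding eventually_at_right_field using bd zero_less_one by blast
  then have "((\<lambda>s. G s - Q s) \<longlongrightarrow> 0) (at_right 0)"
    by (rule Lim_null_comparison[OF _ lim])
  then have G: "(G \<longlongrightarrow> dir_deriv norm a (- b)) (at_right 0)"
    using tendsto_add[OF _ Q, of "\<lambda>s. G s - Q s" 0] by simp
  have "((\<lambda>s. - (G s / 2)) \<longlongrightarrow> - (dir_deriv norm a (- b) / 2)) (at_right 0)"
    by (intro tendsto_intros G) simp
  moreover have "((hm_norm ip (x + (- s) *\<^sub>R y))\<^sup>2 - (hm_norm ip x)\<^sup>2) / (2 * (- s)) = - (G s / 2)" for s
    unfolding hm_norm_sq ip_self_add_scaleR G_def a_def b_def c_def by (simp add: algebra_simps)
  ultimately show ?thesis
    unfolding a_def b_def filterlim_at_left_to_right[where a=0] by (simp only: minus_zero)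
qed

lemma norm_deriv_minus_eq:
  "norm_deriv_minus (hm_norm ip) x y = - (dir_deriv norm (ip x x) (- (ip x y + ip y x)) / 2)"
  unfolding norm_deriv_minus_def
  by (rule tendsto_Lim[OF _ tendsto_quotient_at_left]) simp

text \<open>The real part \<open>f\<close> of the state lies below the norm and touches it at
  \<open>a = ip x x\<close>. So \<open>f v = f (v + t a) - t * norm a\<close> is below every term of
  the infimum at \<open>v\<close>.\<close>

lemma norm_deriv_minus_le:
  assumes "\<psi> \<in> Omega ip x"
  shows "norm_deriv_minus (hm_norm ip) x y \<le> Re (\<psi> (ip x y))"
proof -
  define f where "f v = Re (\<psi> v)" for v
  have \<psi>: "cstate \<psi>" and fa: "f (ip x x) = norm (ip x x)"
    using assms by (auto simp: Omega_def hm_norm_sq f_def)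
  have f: "linear f" unfolding f_def by (rule cstate_Re_linear[OF \<psi>])
  have le: "f v \<le> norm v" for v
    using cstate_norm_le[OF \<psi>, of v] complex_Re_le_cmod[of "\<psi> v"] by (simp add: f_def)
  have "f (- (ip x y + ip y x)) \<le> dir_deriv norm (ip x x) (- (ip x y + ip y x))"
  proof (rule dir_deriv_greatest)
    fix t :: real
    show "f (- (ip x y + ip y x)) \<le> norm (- (ip x y + ip y x) + t *\<^sub>R ip x x) - t * norm (ip x x)"
      using le[of "- (ip x y + ip y x) + t *\<^sub>R ip x x"]
      by (simp add: linear_add[OF f] linear_scale[OF f] fa)
  qed
  also have "f (- (ip x y + ip y x)) = - (2 * Re (\<psi> (ip x y)))"
    unfolding linear_neg[OF f] linear_add[OF f] by (simp add: f_def Re_cstate_ip_swap[OF \<psi>])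
  finally show ?thesis by (simp add: norm_deriv_minus_eq)
qed

lemma norm_deriv_minus_attained:
  assumes nontriv: "\<exists>a::'a. a \<noteq> 0"
  obtains \<phi> where "\<phi> \<in> Omega ip x" "norm_deriv_minus (hm_norm ip) x y = Re (\<phi> (ip x y))"
proof -
  obtain b where b: "ip x x = cstar b * b" using cpos_ip_self unfolding cpos_def by blast
  show ?thesis
  proof (cases "b = 0")
    case False
    \<comment> \<open>Two nested derivatives: domination by the one at \<open>ip x x\<close> forces
      norming there, and the outer one gives equality in the required direction.\<close>
    obtain f where f: "linear f" and fd: "\<And>v. f v \<le> dir_deriv norm (ip x x) v"
      and fb: "f (- (ip x y + ip y x)) = dir_deriv norm (ip x x) (- (ip x y + ip y x))"
      using Hahn_Banach_attaining[OF sublinear_dir_deriv[OF sublinear_norm]] by metis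
    have le: "f v \<le> norm v" for v
      using fd[of v] dir_deriv_le_self[OF sublinear_norm, of "ip x x" v] by simp
    have "- f (ip x x) \<le> - norm (ip x x)"
      using fd[of "- ip x x"] dir_deriv_minus_self[OF sublinear_norm, of "ip x x"]
      by (simp add: linear_neg[OF f])
    then have norming: "f (ip x x) = norm (ip x x)" using le[of "ip x x"] by simp
    note state = cstate_complexify[OF f le norming[unfolded b] False, folded b]
    have "complexify f \<in> Omega ip x"
      using state by (simp add: Omega_def hm_norm_sq)
    \<comment> \<open>The real part of \<open>ip x y\<close> is half of
      \<open>ip x y + ip y x\<close>.\<close>
    moreover have "Re (complexify f (ip x y)) = f (ip x y + ip y x) / 2"
      by (simp add: complexify_def re_part_def cstar_ip linear_scale[OF f])
    then have "norm_deriv_minus (hm_norm ip) x y = Re (complexify f (ip x y))"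
      unfolding norm_deriv_minus_eq fb[symmetric] linear_neg[OF f] by simp
    ultimately show ?thesis using that by blast
  next
    case True
    then have x: "x = 0" using b ip_self_eq_zero by simp
    \<comment> \<open>For \<open>x = 0\<close> the derivative vanishes and every state lies in
      \<open>Omega ip x\<close>; a nonzero \<open>d\<close> supplies one that norms
      \<open>cstar d * d\<close>.\<close>
    obtain d :: 'a where d: "d \<noteq> 0" using nontriv by blast
    obtain f where f: "linear f" and le: "\<And>v. f v \<le> norm v"
      and norming: "f (cstar d * d) = norm (cstar d * d)"
      using Hahn_Banach_attaining[OF sublinear_norm] by metis
    note state = cstate_complexify[OF f le norming d]
    have zero: "complexify f 0 = 0"
      using complexify_cscale[OF f, of 0 0] by simp
    have ip0: "ip 0 y = 0" "ip y 0 = 0"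
      using ip_zero_left cstar_ip[of 0 y] by simp_all
    have "complexify f \<in> Omega ip x"
      using state by (simp add: Omega_def hm_norm_sq x ip_zero_left zero)
    moreover have "norm_deriv_minus (hm_norm ip) x y = 0"
      unfolding norm_deriv_minus_eq x
      by (simp add: ip0 sublinear_zero sublinear_dir_deriv sublinear_norm)
    ultimately show ?thesis using that zero by (simp add: x ip0)
  qed
qed

end

theorem theorem2p4:
  fixes act :: "'x::cvector \<Rightarrow> 'a::cstar_algebra \<Rightarrow> 'x"
    and ip :: "'x \<Rightarrow> 'x \<Rightarrow> 'a"
    and x y :: 'x
  assumes nontriv: "\<exists>a::'a. a \<noteq> 0"
    and hm: "hilbert_module act ip"
  shows "((\<lambda>t::real. ((hm_norm ip (x + t *\<^sub>R y))\<^sup>2 - (hm_norm ip x)\<^sup>2) / (2 * t))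
            \<longlongrightarrow> norm_deriv_minus (hm_norm ip) x y) (at_left 0)
       \<and> (\<exists>\<phi>\<in>Omega ip x. norm_deriv_minus (hm_norm ip) x y = Re (\<phi> (ip x y))
              \<and> (\<forall>\<psi>\<in>Omega ip x. Re (\<phi> (ip x y)) \<le> Re (\<psi> (ip x y))))"
proof -
  interpret hilbert_module_ip act ip by (unfold_locales) (rule hm)
  obtain \<phi> where \<phi>: "\<phi> \<in> Omega ip x"
    and eq: "norm_deriv_minus (hm_norm ip) x y = Re (\<phi> (ip x y))"
    using norm_deriv_minus_attained[OF nontriv] by blast
  have min: "\<forall>\<psi>\<in>Omega ip x. Re (\<phi> (ip x y)) \<le> Re (\<psi> (ip x y))"
    unfolding eq[symmetric] by (intro ballI norm_deriv_minus_le)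
  show ?thesis
    unfolding norm_deriv_minus_eq[of x y]
    by (intro conjI tendsto_quotient_at_left bexI[where x=\<phi>] min \<phi> eq[unfolded norm_deriv_minus_eq])
qed

end
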